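(* Let $T$ and $D$ be the random $m\times n$ Toeplitz matrix and the random $n\times n$ diagonal matrix in the Hinrichs–Vybíral embedding $x\mapsto \frac{1}{\sqrt m}TDx$ (defined in the context). For all $0<\varepsilon<C$, where $C$ is a universal constant, and any desired error probability $\delta>0$, if the following holds for every unit vector $x\in\mathbb{R}^n$: $$\Pr\left[\left|\left\|\tfrac{1}{\sqrt m}TDx\right\|_2^2-1\right|<\varepsilon\right]>1-\delta,$$ then it must be the case that $m=\Omega(\varepsilon^{-2}\lg^2(1/\delta))$.
   Context: A Rademacher random variable is uniform on $\{-1,+1\}$. Let $t_{-(m-1)},t_{-(m-2)},\dots,t_{n-1}$ and $d_1,\dots,d_n$ be i.i.d. Rademacher random variables. The Toeplitz matrix $T$ is the $m\times n$ matrix with $(i,j)$ entry $t_{j-i}$ for $i=1,\dots,m$, $j=1,\dots,n$, and $D$ is the $n\times n$ diagonal matrix with $i$-th diagonal entry $d_i$. $\lg$ is the base-2 logarithm. A unit vector is a vector of Euclidean norm $1$. The $\Omega$ hides a universal positive constant.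
   Formalization: Proved for δ ≤ 1 and n ≥ N(δ), where N depends only on δ and N(δ) = O(lg(1/δ)) as δ → 0; without a lower bound on n the claim is false (for n = 1, m = 1 the squared norm is always exactly 1), and for δ > 1 the hypothesis is void. *)

theory Defs
  imports
    "HOL-Probability.Product_PMF"
    "HOL-Library.Landau_Symbols"
    "Jordan_Normal_Form.Matrix"
begin

text \<open>
  The dimensions \<open>m\<close> and \<open>n\<close> are numbers rather than types, because the constants of the
  lower bound must not depend on them. Hence vectors and matrices are those of
  \<^theory>\<open>Jordan_Normal_Form.Matrix\<close>, whose indices start at 0.
\<close>

unbundle no vec_syntax

definition rademacher :: "real pmf" where
  "rademacher = pmf_of_set {-1, 1}"

text \<open>
  The joint law of the Toeplitz entries and the diagonal entries; all coordinates
  are independent. Outside their index sets the two families take the dummy value 0, which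
  the matrices below never read.
\<close>
definition signs_pmf :: "nat \<Rightarrow> nat \<Rightarrow> ((int \<Rightarrow> real) \<times> (nat \<Rightarrow> real)) pmf" where
  "signs_pmf m n =
     pair_pmf (Pi_pmf {- (int m - 1)..int n - 1} 0 (\<lambda>_. rademacher))
              (Pi_pmf {..<n} 0 (\<lambda>_. rademacher))"

text \<open>The difference \<open>j - i\<close> is the same for indices from 0 as for indices from 1.\<close>
definition toeplitz_mat :: "nat \<Rightarrow> nat \<Rightarrow> (int \<Rightarrow> real) \<Rightarrow> real mat" where
  "toeplitz_mat m n t = mat m n (\<lambda>(i, j). t (int j - int i))"

definition euclidean_norm :: "real Matrix.vec \<Rightarrow> real" where
  "euclidean_norm v = L2_set (\<lambda>i. v $ i) {..<dim_vec v}"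

definition hv_embedding ::
    "nat \<Rightarrow> nat \<Rightarrow> (int \<Rightarrow> real) \<times> (nat \<Rightarrow> real) \<Rightarrow> real Matrix.vec \<Rightarrow> real Matrix.vec" where
  "hv_embedding m n = (\<lambda>(t, d) x.
     (1 / sqrt (real m)) \<cdot>\<^sub>v ((toeplitz_mat m n t * mat_diag n d) *\<^sub>v x))"

end

theory Submission
  imports Defs
begin

text \<open>
  Let \<open>L = lg(1/\<delta>)\<close>. If \<open>L\<close> is large, take \<open>x\<close> uniform on the first \<open>k = 2h\<close> coordinates, where \<open>h\<close> is
  a small multiple of \<open>L\<close>. At the price of a factor \<open>2\<^sup>-\<^sup>k\<close> all signs \<open>d\<^sub>j\<close> are 1 there, and then
  \<open>m k (\<parallel>TDx\<parallel>\<^sup>2 / m - 1)\<close> is the sum of \<open>W\<^sub>i\<^sup>2 - k\<close> over the windows of \<open>k\<close> consecutive entries of \<open>t\<close>. Overlapping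
  windows are correlated, which is where the second factor \<open>lg(1/\<delta>)\<close> comes from. Cut \<open>t\<close> into
  \<open>G \<le> h\<close> blocks of length \<open>M\<close>. The windows inside one block contribute a centred quadratic form of
  standard deviation of order \<open>sqrt (M h\<^sup>3)\<close>, which exceeds a tenth of it with probability at least
  1/200 because its fourth moment is at most 27 times its squared variance. The blocks are
  independent, and a window across two blocks contributes at least \<open>-k\<close>. Hence with probability
  \<open>exp (- O(L))\<close> the distortion is at least of order \<open>L / sqrt m\<close>.

  If \<open>L\<close> is bounded, then \<open>1 - \<delta>\<close> is at least a multiple of \<open>L\<close>, and it suffices to find \<open>x\<close> for which
  the distortion is below \<open>\<epsilon>\<close> with probability \<open>O(\<epsilon> sqrt m)\<close>. For \<open>m \<ge> 4 / (1 - \<delta>)\<^sup>2\<close> two coordinates suffice. The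
  finitely many smaller \<open>m\<close>, for which \<open>n\<close> may be assumed large, need a smoother distribution.
\<close>

section \<open>Averages over signs\<close>

text \<open>
  Coordinates outside \<open>A\<close> keep the values of \<open>t\<close>, so \<open>signs_exp A f\<close> is the conditional
  expectation of \<open>f\<close> given these coordinates, again as a function on the full space.
\<close>
definition signs_exp :: "'i set \<Rightarrow> (('i \<Rightarrow> real) \<Rightarrow> real) \<Rightarrow> ('i \<Rightarrow> real) \<Rightarrow> real" where
  "signs_exp A f t =
     measure_pmf.expectation (Pi_pmf A 0 (\<lambda>_. rademacher)) (\<lambda>s. f (override_on t s A))"

lemma set_pmf_rademacher: "set_pmf rademacher = {-1, 1}"
  by (simp add: rademacher_def)

lemma finite_set_Pi_rademacher: "finite A \<Longrightarrow> finite (set_pmf (Pi_pmf A 0 (\<lambda>_. rademacher)))"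
  by (subst set_Pi_pmf) (auto intro!: finite_PiE_dflt simp: set_pmf_rademacher)

lemma signs_exp_empty [simp]: "signs_exp {} f t = f t"
  by (simp add: signs_exp_def)

lemma signs_exp_insert:
  assumes "finite A" "a \<notin> A"
  shows "signs_exp (insert a A) f t = (signs_exp A f (t(a := 1)) + signs_exp A f (t(a := -1))) / 2"
proof -
  have ov: "override_on t (s(a := y)) (insert a A) = override_on (t(a := y)) s A" for s y
    using assms(2) by (auto simp: override_on_def fun_eq_iff)
  have "signs_exp (insert a A) f t =
    measure_pmf.expectation (pmf_of_set {-1, 1::real} \<bind>
      (\<lambda>y. map_pmf (\<lambda>s. s(a := y)) (Pi_pmf A 0 (\<lambda>_. rademacher))))
      (\<lambda>s. f (override_on t s (insert a A)))"
    unfolding signs_exp_def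
    by (subst Pi_pmf_insert') (use assms in \<open>auto simp: rademacher_def map_pmf_def\<close>)
  also have "\<dots> = (\<Sum>y\<in>{-1, 1}. signs_exp A f (t(a := y)) / 2)"
    by (subst pmf_expectation_bind_pmf_of_set)
      (use assms in \<open>auto simp: finite_set_Pi_rademacher ov signs_exp_def field_simps\<close>)
  finally show ?thesis by (simp add: field_simps)
qed

text \<open>\<open>signs_exp_insert\<close> keeps the new sign outside the average; here it is
  averaged first, inside the integrand. The recursions below need this order to simplify the
  integrand before the induction hypothesis is applied to \<open>A\<close>.\<close>

lemma signs_exp_insert_inner:
  assumes "finite A" "a \<notin> A"
  shows "signs_exp (insert a A) f t = signs_exp A (\<lambda>t. (f (t(a := 1)) + f (t(a := -1))) / 2) t"
  using assms
proof (induction A arbitrary: t rule: finite_induct)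
  case (insert b A)
  have "insert a (insert b A) = insert b (insert a A)" by auto
  moreover have "signs_exp (insert b (insert a A)) f t =
     (signs_exp (insert a A) f (t(b := 1)) + signs_exp (insert a A) f (t(b := -1))) / 2"
    using insert by (intro signs_exp_insert) auto
  ultimately show ?case using insert by (simp add: signs_exp_insert)
qed (simp add: signs_exp_insert)

lemma signs_exp_Un:
  assumes "finite A" "finite B" "A \<inter> B = {}"
  shows "signs_exp (A \<union> B) f t = signs_exp A (signs_exp B f) t"
  using assms
proof (induction A arbitrary: t rule: finite_induct)
  case (insert a A)
  have "signs_exp (insert a (A \<union> B)) f t =
     (signs_exp (A \<union> B) f (t(a := 1)) + signs_exp (A \<union> B) f (t(a := -1))) / 2"
    using insert by (intro signs_exp_insert) auto
  then show ?case using insert by (simp add: signs_exp_insert)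
qed simp

text \<open>Facts that hold only on the support, such as \<open>(s a)\<^sup>2 = 1\<close> or the
  fixed values outside \<open>A\<close>, enter later estimates through this premise.\<close>

lemma signs_exp_mono:
  assumes "finite A"
    and "\<And>s. (\<forall>a\<in>A. s a = 1 \<or> s a = -1) \<Longrightarrow> (\<forall>a. a \<notin> A \<longrightarrow> s a = t a) \<Longrightarrow> f s \<le> g s"
  shows "signs_exp A f t \<le> signs_exp A g t"
  using assms
proof (induction A arbitrary: t rule: finite_induct)
  case empty
  then show ?case using empty(1)[of t] by simp
next
  case (insert a A)
  have "signs_exp A f (t(a := y)) \<le> signs_exp A g (t(a := y))" if "y = 1 \<or> y = -1" for y
    using insert.hyps that by (intro insert.IH insert.prems) auto
  then show ?case using insert.hyps by (auto simp: signs_exp_insert intro!: add_mono)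
qed

lemma signs_exp_cong:
  assumes "finite A"
    and "\<And>s. (\<forall>a\<in>A. s a = 1 \<or> s a = -1) \<Longrightarrow> (\<forall>a. a \<notin> A \<longrightarrow> s a = t a) \<Longrightarrow> f s = g s"
  shows "signs_exp A f t = signs_exp A g t"
  using assms by (intro antisym signs_exp_mono) auto

lemma signs_exp_add:
  "finite A \<Longrightarrow> signs_exp A (\<lambda>s. f s + g s) t = signs_exp A f t + signs_exp A g t"
  by (induction A arbitrary: t rule: finite_induct) (auto simp: signs_exp_insert field_simps)

lemma signs_exp_cmult: "finite A \<Longrightarrow> signs_exp A (\<lambda>s. c * f s) t = c * signs_exp A f t"
  by (induction A arbitrary: t rule: finite_induct) (auto simp: signs_exp_insert field_simps)

lemma signs_exp_const [simp]: "finite A \<Longrightarrow> signs_exp A (\<lambda>_. c) t = c"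
  by (induction A arbitrary: t rule: finite_induct) (auto simp: signs_exp_insert)

lemma signs_exp_sum:
  "finite A \<Longrightarrow> signs_exp A (\<lambda>s. \<Sum>i\<in>I. f i s) t = (\<Sum>i\<in>I. signs_exp A (f i) t)"
  by (induction I rule: infinite_finite_induct) (auto simp: signs_exp_add)

lemma signs_exp_nonneg: "finite A \<Longrightarrow> (\<And>s. 0 \<le> f s) \<Longrightarrow> 0 \<le> signs_exp A f t"
  using signs_exp_mono[of A t "\<lambda>_. 0" f] by simp

lemma signs_exp_factor:
  assumes "finite A" "\<And>s s'. (\<forall>a. a \<notin> A \<longrightarrow> s a = s' a) \<Longrightarrow> g s = g s'"
  shows "signs_exp A (\<lambda>s. g s * f s) t = g t * signs_exp A f t"
proof -
  have "signs_exp A (\<lambda>s. g s * f s) t = signs_exp A (\<lambda>s. g t * f s) t"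
    using assms(1) by (rule signs_exp_cong) (metis assms(2))
  then show ?thesis using assms(1) by (simp add: signs_exp_cmult)
qed

lemma signs_exp_Cauchy_Schwarz:
  assumes "finite A"
  shows "(signs_exp A (\<lambda>s. f s * g s) t)\<^sup>2 \<le> signs_exp A (\<lambda>s. (f s)\<^sup>2) t * signs_exp A (\<lambda>s. (g s)\<^sup>2) t"
proof -
  define a b c where "a = signs_exp A (\<lambda>s. (f s)\<^sup>2) t" and "b = signs_exp A (\<lambda>s. f s * g s) t"
    and "c = signs_exp A (\<lambda>s. (g s)\<^sup>2) t"
  have q: "0 \<le> u\<^sup>2 * a + 2 * u * v * b + v\<^sup>2 * c" for u v :: real
  proof -
    have "0 \<le> signs_exp A (\<lambda>s. (u * f s + v * g s)\<^sup>2) t"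
      using assms by (intro signs_exp_nonneg) auto
    also have "(\<lambda>s. (u * f s + v * g s)\<^sup>2)
       = (\<lambda>s. (u\<^sup>2 * (f s)\<^sup>2 + 2 * u * v * (f s * g s)) + v\<^sup>2 * (g s)\<^sup>2)"
      by (auto simp: fun_eq_iff power2_eq_square algebra_simps)
    also have "signs_exp A \<dots> t = u\<^sup>2 * a + 2 * u * v * b + v\<^sup>2 * c"
      using assms by (simp only: signs_exp_add signs_exp_cmult a_def b_def c_def)
    finally show ?thesis .
  qed
  have nn: "0 \<le> a" "0 \<le> c" using assms by (auto simp: a_def c_def intro!: signs_exp_nonneg)
  show ?thesis
  proof (cases "a = 0")
    case True
    \<comment> \<open>For \<open>a = 0\<close> the form is linear in \<open>u\<close>; this choice
      turns it into \<open>- (b\<^sup>2 * (c + 2))\<close>.\<close>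
    have "0 \<le> (- (c + 1))\<^sup>2 * a + 2 * (- (c + 1)) * b * b + b\<^sup>2 * c"
      by (rule q)
    then have "b\<^sup>2 * (c + 2) \<le> 0" using True by (simp add: algebra_simps power2_eq_square)
    then have "b = 0" using nn by (simp add: mult_le_0_iff)
    then show ?thesis using nn by (simp add: a_def b_def c_def)
  next
    case False
    then have "0 \<le> (b\<^sup>2 * a + 2 * b * (- a) * b + (- a)\<^sup>2 * c) / a"
      using q[of b "-a"] nn by (intro divide_nonneg_nonneg) auto
    moreover have "(b\<^sup>2 * a + 2 * b * (- a) * b + (- a)\<^sup>2 * c) / a = a * c - b\<^sup>2"
      using False by (simp add: field_simps power2_eq_square)
    ultimately have "0 \<le> a * c - b\<^sup>2" by simp
    then show ?thesis by (simp add: a_def b_def c_def)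
  qed
qed

lemma signs_exp_superset_ge:
  assumes "finite A" "B \<subseteq> A" "\<And>t. p \<le> signs_exp B f t"
  shows "p \<le> signs_exp A f t"
proof -
  have fin: "finite B" "finite (A - B)" using assms finite_subset by auto
  have "signs_exp A f t = signs_exp ((A - B) \<union> B) f t"
    using assms(2) by (simp add: Un_absorb2)
  also have "\<dots> = signs_exp (A - B) (signs_exp B f) t"
    using fin by (intro signs_exp_Un) auto
  finally show ?thesis
    using signs_exp_mono[OF fin(2), of t "\<lambda>_. p" "signs_exp B f"] assms(3) fin by simp
qed

text \<open>Averaging a bound that is uniform in the fixed coordinates. Those in
  \<open>A - B\<close> may be taken to be signs, which \<open>separated_small_ball\<close> needs to
  control the fixed part of a row.\<close>

lemma signs_exp_superset_le:
  assumes "finite A" "B \<subseteq> A"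
    and "\<And>t. (\<forall>a\<in>A - B. t a = 1 \<or> t a = -1) \<Longrightarrow> signs_exp B f t \<le> p"
  shows "signs_exp A f t \<le> p"
proof -
  have fin: "finite B" "finite (A - B)" using assms finite_subset by auto
  have "signs_exp A f t = signs_exp ((A - B) \<union> B) f t"
    using assms(2) by (simp add: Un_absorb2)
  also have "\<dots> = signs_exp (A - B) (signs_exp B f) t"
    using fin by (intro signs_exp_Un) auto
  also have "\<dots> \<le> signs_exp (A - B) (\<lambda>_. p) t"
    using fin assms(3) by (intro signs_exp_mono) auto
  finally show ?thesis using fin by simp
qed

text \<open>Independence of disjoint blocks: each factor reads only its own block, so the other
  factors are constants for the average over the last block.\<close>

lemma signs_exp_prod_ge:
  fixes f :: "nat \<Rightarrow> ('i \<Rightarrow> real) \<Rightarrow> real"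
  assumes "\<And>g. g < G \<Longrightarrow> finite (B g)" "\<And>g h. g < h \<Longrightarrow> h < G \<Longrightarrow> B g \<inter> B h = {}"
    and "\<And>g s. 0 \<le> f g s" "0 \<le> p"
    and "\<And>g t. g < G \<Longrightarrow> p \<le> signs_exp (B g) (f g) t"
    and "\<And>g s s'. g < G \<Longrightarrow> (\<forall>a\<in>B g. s a = s' a) \<Longrightarrow> f g s = f g s'"
  shows "p ^ G \<le> signs_exp (\<Union>g<G. B g) (\<lambda>s. \<Prod>g<G. f g s) t"
  using assms
proof (induction G arbitrary: t)
  case (Suc G)
  have U: "(\<Union>g<Suc G. B g) = (\<Union>g<G. B g) \<union> B G" by (auto simp: less_Suc_eq)
  have dis: "(\<Union>g<G. B g) \<inter> B G = {}"
    using Suc.prems(2)[of _ G] by fastforce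
  have fin: "finite (\<Union>g<G. B g)" "finite (B G)" using Suc.prems(1) by auto
  have eq: "signs_exp (B G) (\<lambda>s. (\<Prod>g<G. f g s) * f G s) s =
      (\<Prod>g<G. f g s) * signs_exp (B G) (f G) s" for s
  proof (rule signs_exp_factor[OF fin(2)])
    fix s s' :: "'i \<Rightarrow> real" assume "\<forall>a. a \<notin> B G \<longrightarrow> s a = s' a"
    then show "(\<Prod>g<G. f g s) = (\<Prod>g<G. f g s')"
      using dis by (intro prod.cong refl Suc.prems(6)) auto
  qed
  have "p ^ Suc G \<le> signs_exp (\<Union>g<G. B g) (\<lambda>s. \<Prod>g<G. f g s) t * p"
    using Suc.prems(4) by (subst power_Suc2) (intro mult_right_mono Suc.IH Suc.prems; simp)
  also have "\<dots> = signs_exp (\<Union>g<G. B g) (\<lambda>s. p * (\<Prod>g<G. f g s)) t"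
    using fin by (simp add: signs_exp_cmult mult.commute)
  also have "\<dots> \<le> signs_exp (\<Union>g<G. B g) (\<lambda>s. (\<Prod>g<G. f g s) * signs_exp (B G) (f G) s) t"
    using fin(1)
    by (intro signs_exp_mono) (auto simp: mult.commute[of p] intro!: mult_left_mono prod_nonneg Suc.prems)
  also have "\<dots> = signs_exp (\<Union>g<Suc G. B g) (\<lambda>s. \<Prod>g<Suc G. f g s) t"
    unfolding U using fin dis by (subst signs_exp_Un) (simp_all add: eq[abs_def])
  finally show ?case .
qed simp

lemma signs_exp_all_ones:
  assumes "finite A"
  shows "signs_exp A (\<lambda>s. of_bool (\<forall>a\<in>A. s a = 1)) t = (1/2) ^ card A"
  using assms
proof (induction A arbitrary: t rule: finite_induct)
  case (insert a A)
  have "signs_exp A (\<lambda>s. of_bool (\<forall>b\<in>insert a A. s b = 1)) (t(a := 1)) =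
        signs_exp A (\<lambda>s. of_bool (\<forall>b\<in>A. s b = 1)) (t(a := 1))"
    using insert.hyps by (intro signs_exp_cong) auto
  moreover have "signs_exp A (\<lambda>s. of_bool (\<forall>b\<in>insert a A. s b = 1)) (t(a := -1)) =
        signs_exp A (\<lambda>s. 0) (t(a := -1))"
    using insert.hyps by (intro signs_exp_cong) auto
  ultimately show ?case using insert by (simp add: signs_exp_insert)
qed simp

section \<open>Probabilities for the embedding\<close>

text \<open>The diagonal signs are averaged last, so that estimates can be made for fixed
  \<open>d\<close>.\<close>

lemma prob_signs_pmf:
  "measure_pmf.prob (signs_pmf m n) {s. P s} =
     signs_exp {..<n} (\<lambda>d. signs_exp {- (int m - 1)..int n - 1} (\<lambda>t. of_bool (P (t, d))) (\<lambda>_. 0)) (\<lambda>_. 0)"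
proof -
  let ?T = "Pi_pmf {- (int m - 1)..int n - 1} 0 (\<lambda>_. rademacher)"
  let ?D = "Pi_pmf {..<n} 0 (\<lambda>_. rademacher)"
  \<comment> \<open>A sample of \<open>Pi_pmf\<close> has the default value 0 outside
    \<open>A\<close>, which is the base point.\<close>
  have ov: "override_on (\<lambda>_. 0) s A = s" if "s \<in> set_pmf (Pi_pmf A 0 (\<lambda>_. rademacher))" "finite A"
    for s and A :: "'z set"
  proof -
    have "s a = 0" if "a \<notin> A" for a
      using \<open>s \<in> _\<close> \<open>finite A\<close> that by (auto simp: set_Pi_pmf PiE_dflt_def)
    then show ?thesis by (auto simp: override_on_def)
  qed
  have finT: "finite (set_pmf ?T)" and finD: "finite (set_pmf ?D)"
    by (simp_all add: finite_set_Pi_rademacher)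
  have eq: "signs_pmf m n = ?D \<bind> (\<lambda>d. map_pmf (\<lambda>t. (t, d)) ?T)"
    unfolding signs_pmf_def pair_pmf_def map_pmf_def by (rule bind_commute_pmf)
  have "measure_pmf.prob (signs_pmf m n) {s. P s} =
      measure_pmf.expectation (signs_pmf m n) (indicator {s. P s})"
    by simp
  also have "(indicator {s. P s} :: _ \<Rightarrow> real) = (\<lambda>s. of_bool (P s))"
    by (auto simp: indicator_def)
  also have "measure_pmf.expectation (signs_pmf m n) \<dots> = (\<Sum>d\<in>set_pmf ?D. pmf ?D d *
      measure_pmf.expectation ?T (\<lambda>t. of_bool (P (t, d))))"
    unfolding eq by (subst pmf_expectation_bind[of "set_pmf ?D"]) (use finT finD in auto)
  also have "\<dots> = (\<Sum>d\<in>set_pmf ?D. pmf ?D d * measure_pmf.expectation ?T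
      (\<lambda>t. of_bool (P (override_on (\<lambda>_. 0) t {- (int m - 1)..int n - 1},
                       override_on (\<lambda>_. 0) d {..<n}))))"
    by (intro sum.cong arg_cong2[of _ _ _ _ "(*)"] refl integral_cong_AE)
       (auto simp: AE_measure_pmf_iff ov simp del: atLeastAtMost_iff)
  also have "\<dots> = measure_pmf.expectation ?D (\<lambda>d. measure_pmf.expectation ?T
      (\<lambda>t. of_bool (P (override_on (\<lambda>_. 0) t {- (int m - 1)..int n - 1},
                       override_on (\<lambda>_. 0) d {..<n}))))"
    by (subst integral_measure_pmf[of "set_pmf ?D"]) (use finD in auto)
  finally show ?thesis by (simp add: signs_exp_def)
qed

lemma signs_prob_le:
  assumes "\<And>d. (\<forall>j<n. d j = 1 \<or> d j = -1) \<Longrightarrow>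
      signs_exp {- (int m - 1)..int n - 1} (\<lambda>t. of_bool (P (t, d))) (\<lambda>_. 0) \<le> p"
  shows "measure_pmf.prob (signs_pmf m n) {s. P s} \<le> p"
proof -
  have "measure_pmf.prob (signs_pmf m n) {s. P s} \<le> signs_exp {..<n} (\<lambda>_. p) (\<lambda>_. 0)"
    unfolding prob_signs_pmf using assms by (intro signs_exp_mono) auto
  then show ?thesis by simp
qed

lemma prob_less_le_complement:
  assumes "p \<le> measure_pmf.prob M {s. \<epsilon> \<le> X s}"
  shows "measure_pmf.prob M {s. X s < (\<epsilon> :: real)} \<le> 1 - p"
proof -
  have "{s. X s < \<epsilon>} = UNIV - {s. \<epsilon> \<le> X s}" by auto
  then show ?thesis using assms measure_pmf.prob_compl[of "{s. \<epsilon> \<le> X s}" M] by simp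
qed

lemma hv_embedding_norm:
  assumes "x \<in> carrier_vec n"
  shows "(euclidean_norm (hv_embedding m n (t, d) x))\<^sup>2 =
     (\<Sum>i<m. (\<Sum>j<n. t (int j - int i) * d j * x $ j)\<^sup>2) / real m"
proof -
  have row: "hv_embedding m n (t, d) x $ i =
      (1 / sqrt (real m)) * (\<Sum>j<n. t (int j - int i) * d j * x $ j)" if "i < m" for i
  proof -
    have "toeplitz_mat m n t * mat_diag n d = mat m n (\<lambda>(i, j). t (int j - int i) * d j)"
      by (subst mat_diag_mult_right[of _ m]) (auto simp: toeplitz_mat_def)
    then show ?thesis
      using assms that
      by (simp add: hv_embedding_def scalar_prod_def atLeast0LessThan)
  qed
  have dim: "dim_vec (hv_embedding m n (t, d) x) = m"
    by (simp add: hv_embedding_def toeplitz_mat_def)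
  have "(euclidean_norm (hv_embedding m n (t, d) x))\<^sup>2 =
      (\<Sum>i<m. (hv_embedding m n (t, d) x $ i)\<^sup>2)"
    by (simp add: euclidean_norm_def L2_set_def dim sum_nonneg)
  also have "\<dots> = (\<Sum>i<m. (\<Sum>j<n. t (int j - int i) * d j * x $ j)\<^sup>2 / real m)"
    by (intro sum.cong refl) (simp add: row power_mult_distrib power_divide)
  finally show ?thesis by (simp add: sum_divide_distrib)
qed

section \<open>Moments of quadratic forms in signs\<close>

text \<open>With a new term \<open>y\<close> the odd powers cancel, so the fourth moment grows by
  \<open>6 * y\<^sup>2\<close> times the second moment plus \<open>y ^ 4\<close>. This is dominated
  by the expansion of \<open>3 * (S + y\<^sup>2)\<^sup>2\<close>.\<close>

lemma linear_form_moments: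
  fixes c :: "'i \<Rightarrow> real"
  assumes "finite A"
  shows "signs_exp A (\<lambda>s. (\<Sum>a\<in>A. c a * s a)\<^sup>2) t = (\<Sum>a\<in>A. (c a)\<^sup>2)"
    and "signs_exp A (\<lambda>s. (\<Sum>a\<in>A. c a * s a) ^ 4) t \<le> 3 * (\<Sum>a\<in>A. (c a)\<^sup>2)\<^sup>2"
  using assms
proof (induction A arbitrary: t rule: finite_induct)
  case (insert b A)
  let ?l = "\<lambda>s. \<Sum>a\<in>A. c a * s a"
  have upd: "(\<Sum>a\<in>insert b A. c a * (s(b := y)) a) = ?l s + c b * y" for s y
  proof -
    have "(\<Sum>a\<in>A. c a * (s(b := y)) a) = ?l s"
      using insert.hyps by (intro sum.cong) auto
    then show ?thesis using insert.hyps by simp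
  qed
  {
    case 1
    have "signs_exp (insert b A) (\<lambda>s. (\<Sum>a\<in>insert b A. c a * s a)\<^sup>2) t =
        signs_exp A (\<lambda>s. (?l s)\<^sup>2 + (c b)\<^sup>2) t"
      by (subst signs_exp_insert_inner) (use insert.hyps in
        \<open>auto simp only: upd intro!: arg_cong[of _ _ "\<lambda>f. signs_exp A f t"], simp add: power2_eq_square algebra_simps add_divide_distrib\<close>)
    then show ?case using insert by (simp add: signs_exp_add)
  next
    case 2
    have poly: "((x + y * 1) ^ 4 + (x + y * - 1) ^ 4) / 2 = (x ^ 4 + (6 * y\<^sup>2) * x\<^sup>2) + y ^ 4" for x y :: real
      by (simp add: power4_eq_xxxx power2_eq_square algebra_simps)
    have "signs_exp (insert b A) (\<lambda>s. (\<Sum>a\<in>insert b A. c a * s a) ^ 4) t =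
        signs_exp A (\<lambda>s. ((?l s) ^ 4 + (6 * (c b)\<^sup>2) * (?l s)\<^sup>2) + (c b) ^ 4) t"
      by (subst signs_exp_insert_inner) (use insert.hyps in \<open>auto simp only: upd poly\<close>)
    also have "\<dots> = signs_exp A (\<lambda>s. (?l s) ^ 4) t + (6 * (c b)\<^sup>2) * (\<Sum>a\<in>A. (c a)\<^sup>2) + (c b) ^ 4"
      using insert by (simp only: signs_exp_add signs_exp_cmult signs_exp_const)
    also have "\<dots> \<le> 3 * (\<Sum>a\<in>A. (c a)\<^sup>2)\<^sup>2 + (6 * (c b)\<^sup>2) * (\<Sum>a\<in>A. (c a)\<^sup>2) + 3 * (c b) ^ 4"
      using insert.IH(2)[of t] zero_le_power2[of "(c b)\<^sup>2"]
      by (simp only: power4_eq_xxxx power2_eq_square)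
    also have "\<dots> = 3 * ((c b)\<^sup>2 + (\<Sum>a\<in>A. (c a)\<^sup>2))\<^sup>2"
      by (simp add: power4_eq_xxxx power2_eq_square algebra_simps)
    finally show ?case using insert.hyps by simp
  }
qed auto

text \<open>Each pair enters once, at its larger index. Adding a new maximum \<open>b\<close>
  therefore adds \<open>s b\<close> times a linear form in the earlier signs, which drives the
  inductions.\<close>

definition quadratic_form :: "('i::linorder \<Rightarrow> 'i \<Rightarrow> real) \<Rightarrow> 'i set \<Rightarrow> ('i \<Rightarrow> real) \<Rightarrow> real" where
  "quadratic_form c A s = (\<Sum>b\<in>A. s b * (\<Sum>a\<in>{a\<in>A. a < b}. c a b * s a))"

lemma below_insert_max:
  assumes "\<And>a. a \<in> A \<Longrightarrow> a < (b :: 'i::linorder)"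
  shows "{a \<in> insert b A. a < b} = A" "x \<in> A \<Longrightarrow> {a \<in> insert b A. a < x} = {a \<in> A. a < x}"
  using assms by (auto dest: order.asym)

lemma quadratic_form_insert_max:
  assumes "finite A" "\<And>a. a \<in> A \<Longrightarrow> a < b"
  shows "quadratic_form c (insert b A) s = quadratic_form c A s + s b * (\<Sum>a\<in>A. c a b * s a)"
proof -
  have "b \<notin> A" using assms(2) by auto
  then show ?thesis
    using assms(1) below_insert_max[of A b, OF assms(2)]
    by (simp add: quadratic_form_def add.commute cong: sum.cong_simp)
qed

lemma quadratic_form_upd: "b \<notin> A \<Longrightarrow> quadratic_form c A (s(b := y)) = quadratic_form c A s"
  by (auto simp: quadratic_form_def intro!: sum.cong arg_cong2[of _ _ _ _ "(*)"])

text \<open>Averaging over the new sign leaves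
  \<open>q ^ 4 + 6 * q\<^sup>2 * l\<^sup>2 + l ^ 4\<close> for the old form \<open>q\<close> and the
  new linear form \<open>l\<close>. The constant 27 reproduces itself: by Cauchy-Schwarz the mixed
  moment is at most \<open>sqrt (27 * 3) = 9\<close> times the product of the variances, and
  \<open>6 * 9 = 2 * 27\<close>.\<close>

lemma quadratic_form_moments:
  fixes c :: "'i::linorder \<Rightarrow> 'i \<Rightarrow> real"
  assumes "finite A"
  defines "V \<equiv> \<lambda>A. \<Sum>b\<in>A. \<Sum>a\<in>{a\<in>A. a < b}. (c a b)\<^sup>2"
  shows "signs_exp A (quadratic_form c A) t = 0"
    and "signs_exp A (\<lambda>s. (quadratic_form c A s)\<^sup>2) t = V A"
    and "signs_exp A (\<lambda>s. (quadratic_form c A s) ^ 4) t \<le> 27 * (V A)\<^sup>2"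
  using assms(1)
proof (induction A arbitrary: t rule: finite_linorder_max_induct)
  case (insert b A)
  let ?l = "\<lambda>s. \<Sum>a\<in>A. c a b * s a"
  let ?q = "quadratic_form c A"
  define S where "S = (\<Sum>a\<in>A. (c a b)\<^sup>2)"
  have bA: "b \<notin> A" using insert.hyps(2) by auto
  have V_ins: "V (insert b A) = V A + S"
    using below_insert_max[of A b] insert.hyps bA
    by (simp add: V_def S_def add.commute cong: sum.cong_simp)
  have V0: "0 \<le> V A" "0 \<le> S" by (auto simp: V_def S_def intro!: sum_nonneg)
  have lupd: "?l (s(b := y)) = ?l s" for s y
    using bA by (intro sum.cong) auto
  have upd: "quadratic_form c (insert b A) (s(b := y)) = ?q s + y * ?l s" for s y
    using insert.hyps bA by (simp add: quadratic_form_insert_max quadratic_form_upd lupd del: fun_upd_apply)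
      (simp add: fun_upd_def)
  note lm = linear_form_moments[OF insert.hyps(1), of "\<lambda>a. c a b", folded S_def]
  {
    case 1
    show ?case
      by (subst signs_exp_insert_inner) (use insert bA in \<open>auto simp only: upd, simp\<close>)
  next
    case 2
    have poly: "((x + 1 * y)\<^sup>2 + (x + - 1 * y)\<^sup>2) / 2 = x\<^sup>2 + y\<^sup>2" for x y :: real
      by (simp add: power2_eq_square algebra_simps)
    show ?case
      by (subst signs_exp_insert_inner)
        (use insert bA lm in \<open>auto simp only: upd poly signs_exp_add V_ins finite\<close>)
  next
    case 3
    have poly: "((x + 1 * y) ^ 4 + (x + - 1 * y) ^ 4) / 2 = (x ^ 4 + 6 * (x\<^sup>2 * y\<^sup>2)) + y ^ 4" for x y :: real
      by (simp add: power4_eq_xxxx power2_eq_square algebra_simps)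
    have cross: "signs_exp A (\<lambda>s. (?q s)\<^sup>2 * (?l s)\<^sup>2) t \<le> 9 * V A * S"
    proof (rule power2_le_imp_le)
      have "(signs_exp A (\<lambda>s. (?q s)\<^sup>2 * (?l s)\<^sup>2) t)\<^sup>2 \<le>
         signs_exp A (\<lambda>s. ((?q s)\<^sup>2)\<^sup>2) t * signs_exp A (\<lambda>s. ((?l s)\<^sup>2)\<^sup>2) t"
        using insert.hyps(1) by (rule signs_exp_Cauchy_Schwarz)
      also have "\<dots> = signs_exp A (\<lambda>s. (?q s) ^ 4) t * signs_exp A (\<lambda>s. (?l s) ^ 4) t"
        by simp
      also have "\<dots> \<le> (27 * (V A)\<^sup>2) * (3 * S\<^sup>2)"
        using insert.hyps(1) by (intro mult_mono insert.IH lm signs_exp_nonneg) auto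
      also have "\<dots> = (9 * V A * S)\<^sup>2" by (simp add: power2_eq_square algebra_simps)
      finally show "(signs_exp A (\<lambda>s. (?q s)\<^sup>2 * (?l s)\<^sup>2) t)\<^sup>2 \<le> (9 * V A * S)\<^sup>2" .
    qed (use V0 in simp)
    have "signs_exp (insert b A) (\<lambda>s. (quadratic_form c (insert b A) s) ^ 4) t =
       signs_exp A (\<lambda>s. ((?q s) ^ 4 + 6 * ((?q s)\<^sup>2 * (?l s)\<^sup>2)) + (?l s) ^ 4) t"
      by (subst signs_exp_insert_inner) (use insert.hyps bA in \<open>auto simp only: upd poly\<close>)
    also have "\<dots> = signs_exp A (\<lambda>s. (?q s) ^ 4) t + 6 * signs_exp A (\<lambda>s. (?q s)\<^sup>2 * (?l s)\<^sup>2) t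
        + signs_exp A (\<lambda>s. (?l s) ^ 4) t"
      using insert.hyps(1) by (simp only: signs_exp_add signs_exp_cmult)
    also have "\<dots> \<le> 27 * (V A)\<^sup>2 + 6 * (9 * V A * S) + 27 * S\<^sup>2"
      using insert.IH(3)[of t] lm(2)[of t] cross by (smt (verit) zero_le_power2)
    also have "\<dots> = 27 * (V A + S)\<^sup>2" by (simp add: power2_eq_square algebra_simps)
    finally show ?case by (simp only: V_ins)
  }
qed (auto simp: V_def quadratic_form_def)

text \<open>
  Applied to a normalised \<open>y\<close> of mean 0, variance 1 and fourth moment at most 27, the left-hand
  side has expectation at least 1 - 27/54 - 31/100 > 0, which bounds the upper tail from below.
\<close>
lemma quartic_tail_bound:
  fixes y :: real
  shows "3 * y + y\<^sup>2 - y ^ 4 / 54 - 31 / 100 \<le> 31 * of_bool (1 / 10 \<le> y)"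
proof -
  consider "1 / 10 \<le> y" | "0 \<le> y" "y < 1 / 10" | "y < 0" by linarith
  then show ?thesis
  proof cases
    case 1
    \<comment> \<open>Completing squares bounds \<open>3 * y + y\<^sup>2 - y ^ 4 / 54\<close> by
      about 30.3.\<close>
    have "0 \<le> (y\<^sup>2 - 35)\<^sup>2 / 54 + (16 / 54) * (y - 81 / 16)\<^sup>2" by simp
    then have "3 * y + y\<^sup>2 - y ^ 4 / 54 - 31 / 100 \<le> 31"
      by (simp add: power2_eq_square power4_eq_xxxx field_simps)
    then show ?thesis using 1 by simp
  next
    case 2
    then have "y\<^sup>2 \<le> (1 / 10)\<^sup>2" by (intro power_mono) auto
    then have "y\<^sup>2 \<le> 1 / 100" by (simp add: power2_eq_square)
    moreover have "0 \<le> y ^ 4" by simp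
    ultimately have "3 * y + y\<^sup>2 - y ^ 4 / 54 - 31 / 100 \<le> 0"
      using 2 by linarith
    then show ?thesis using 2 by simp
  next
    case 3
    define z where "z = - y"
    have z: "0 < z" using 3 by (simp add: z_def)
    \<comment> \<open>17/4 approximates the minimiser \<open>sqrt 18\<close> of the cubic
      \<open>z ^ 3 - 54 * z + 162\<close>.\<close>
    have "0 \<le> (z - 17 / 4)\<^sup>2 * (z + 17 / 2) + (3 / 16) * z + 8"
      using z by (intro add_nonneg_nonneg mult_nonneg_nonneg) auto
    also have "\<dots> \<le> z ^ 3 - 54 * z + 162"
      by (simp add: power2_eq_square power3_eq_cube field_simps)
    finally have "0 \<le> z * (z ^ 3 - 54 * z + 162)" using z by simp
    then have "3 * y + y\<^sup>2 - y ^ 4 / 54 \<le> 0"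
      by (simp add: z_def power2_eq_square power4_eq_xxxx power3_eq_cube field_simps)
    then show ?thesis using 3 by simp
  qed
qed

text \<open>Integrating \<open>quartic_tail_bound\<close> at \<open>y = f s / \<sigma>\<close> gives
  at least 19/100 on the left and 31 times the tail on the right; 19/3100 exceeds 1/200.\<close>

lemma fourth_moment_tail:
  assumes A: "finite A" and mean: "signs_exp A f t = 0"
    and var: "signs_exp A (\<lambda>s. (f s)\<^sup>2) t = \<sigma>\<^sup>2" "0 < \<sigma>"
    and four: "signs_exp A (\<lambda>s. (f s) ^ 4) t \<le> 27 * \<sigma> ^ 4"
  shows "1 / 200 \<le> signs_exp A (\<lambda>s. of_bool (\<sigma> / 10 \<le> f s)) t"
proof -
  have "19 / 100 \<le> (3 / \<sigma>) * signs_exp A f t + (1 / \<sigma>\<^sup>2) * signs_exp A (\<lambda>s. (f s)\<^sup>2) t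
      + (- 1 / (54 * \<sigma> ^ 4)) * signs_exp A (\<lambda>s. (f s) ^ 4) t + (- 31 / 100)"
    using four var(2) by (simp add: mean var(1) field_simps)
  also have "\<dots> = signs_exp A (\<lambda>s. (3 / \<sigma>) * f s + (1 / \<sigma>\<^sup>2) * (f s)\<^sup>2
      + (- 1 / (54 * \<sigma> ^ 4)) * (f s) ^ 4 + (- 31 / 100)) t"
    using A by (simp only: signs_exp_add signs_exp_cmult signs_exp_const)
  also have "\<dots> \<le> signs_exp A (\<lambda>s. 31 * of_bool (\<sigma> / 10 \<le> f s)) t"
  proof (rule signs_exp_mono[OF A])
    fix s
    show "(3 / \<sigma>) * f s + (1 / \<sigma>\<^sup>2) * (f s)\<^sup>2 + (- 1 / (54 * \<sigma> ^ 4)) * (f s) ^ 4 + (- 31 / 100)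
        \<le> 31 * of_bool (\<sigma> / 10 \<le> f s)"
      using quartic_tail_bound[of "f s / \<sigma>"] var(2) by (simp add: field_simps power_divide)
  qed
  also have "\<dots> = 31 * signs_exp A (\<lambda>s. of_bool (\<sigma> / 10 \<le> f s)) t"
    using A by (rule signs_exp_cmult)
  finally show ?thesis by simp
qed

lemma square_of_sum:
  fixes s :: "'i::linorder \<Rightarrow> real"
  assumes "finite W"
  shows "(\<Sum>a\<in>W. s a)\<^sup>2 = (\<Sum>a\<in>W. (s a)\<^sup>2) + 2 * quadratic_form (\<lambda>_ _. 1) W s"
  using assms
proof (induction W rule: finite_linorder_max_induct)
  case (insert b A)
  then have "b \<notin> A" by auto
  with insert show ?case
    by (simp add: quadratic_form_insert_max power2_eq_square algebra_simps)
qed (simp add: quadratic_form_def)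

section \<open>Failure probabilities below a constant\<close>

text \<open>For \<open>a < b\<close> this counts the windows of length \<open>k\<close> with
  starting points \<open>z, ..., z + R - 1\<close> that contain both \<open>a\<close> and
  \<open>b\<close>.\<close>

definition window_weight :: "int \<Rightarrow> nat \<Rightarrow> nat \<Rightarrow> int \<Rightarrow> int \<Rightarrow> real" where
  "window_weight z R k a b = (\<Sum>r<R. of_bool (z + int r \<le> a \<and> b < z + int r + int k))"

text \<open>For signs the diagonal terms of each square add up to \<open>k\<close> and cancel. A
  pair survives with factor 2 for each window that contains it.\<close>

lemma window_squares_quadratic_form:
  fixes s :: "int \<Rightarrow> real"
  assumes "\<forall>a\<in>{z..<z + int R + int k - 1}. s a = 1 \<or> s a = -1"
  shows "(\<Sum>r<R. (\<Sum>a\<in>{z + int r..<z + int r + int k}. s a)\<^sup>2 - real k) =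
     quadratic_form (\<lambda>a b. 2 * window_weight z R k a b) {z..<z + int R + int k - 1} s"
proof -
  define B where "B = {z..<z + int R + int k - 1}"
  define W where "W = (\<lambda>r::nat. {z + int r..<z + int r + int k})"
  have fin: "finite {a\<in>B. a < b}" for b
    by (rule finite_subset[of _ B]) (auto simp: B_def)
  have one: "(\<Sum>a\<in>W r. s a)\<^sup>2 - real k =
     (\<Sum>b\<in>B. \<Sum>a\<in>{a\<in>B. a < b}. 2 * of_bool (z + int r \<le> a \<and> b < z + int r + int k) * s a * s b)"
    if "r < R" for r
  proof -
    have sub: "W r \<subseteq> B" using that by (auto simp: W_def B_def)
    have "(\<Sum>a\<in>W r. (s a)\<^sup>2) = (\<Sum>a\<in>W r. 1)"
      using assms sub by (intro sum.cong refl) (force simp: B_def power2_eq_1_iff)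
    then have "(\<Sum>a\<in>W r. s a)\<^sup>2 - real k = 2 * quadratic_form (\<lambda>_ _. 1) (W r) s"
      by (subst square_of_sum) (auto simp: W_def)
    also have "\<dots> = (\<Sum>b\<in>W r. \<Sum>a\<in>{a\<in>W r. a < b}. 2 * s a * s b)"
      by (simp add: quadratic_form_def sum_distrib_left mult_ac)
    also have "\<dots> = (\<Sum>b\<in>W r. \<Sum>a\<in>{a\<in>B. a < b}.
        2 * of_bool (z + int r \<le> a \<and> b < z + int r + int k) * s a * s b)"
      by (rule sum.cong[OF refl], rule sum.mono_neutral_cong_left)
        (use sub fin in \<open>auto simp: W_def\<close>)
    also have "\<dots> = (\<Sum>b\<in>B. \<Sum>a\<in>{a\<in>B. a < b}.
        2 * of_bool (z + int r \<le> a \<and> b < z + int r + int k) * s a * s b)"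
      using sub by (intro sum.mono_neutral_left) (auto simp: W_def B_def intro!: sum.neutral)
    finally show ?thesis .
  qed
  have "(\<Sum>r<R. (\<Sum>a\<in>W r. s a)\<^sup>2 - real k) = (\<Sum>r<R. \<Sum>b\<in>B. \<Sum>a\<in>{a\<in>B. a < b}.
        2 * of_bool (z + int r \<le> a \<and> b < z + int r + int k) * s a * s b)"
    by (intro sum.cong refl one) auto
  also have "\<dots> = (\<Sum>b\<in>B. \<Sum>r<R. \<Sum>a\<in>{a\<in>B. a < b}.
        2 * of_bool (z + int r \<le> a \<and> b < z + int r + int k) * s a * s b)"
    by (rule sum.swap)
  also have "\<dots> = (\<Sum>b\<in>B. \<Sum>a\<in>{a\<in>B. a < b}. \<Sum>r<R.
        2 * of_bool (z + int r \<le> a \<and> b < z + int r + int k) * s a * s b)"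
    by (intro sum.cong refl sum.swap)
  also have "\<dots> = quadratic_form (\<lambda>a b. 2 * window_weight z R k a b) B s"
    unfolding quadratic_form_def window_weight_def
    by (simp only: sum_distrib_left sum_distrib_right mult_ac)
  finally show ?thesis by (simp add: W_def B_def)
qed

text \<open>Up to a factor 4, a lower bound for the variance. Away from the ends of the block, two
  positions at distance at most \<open>h\<close> share at least \<open>h\<close> windows: there are
  \<open>R + 1 - 2 * h\<close> left positions, each with \<open>h\<close> partners and squared
  weight at least \<open>h\<^sup>2\<close>.\<close>

lemma window_weight_sq_sum:
  fixes z :: int
  assumes h: "1 \<le> h" "2 * h \<le> R"
  defines "B \<equiv> {z..<z + int R + int (2 * h) - 1}"
  shows "real (R + 1 - 2 * h) * real h ^ 3 \<le>
     (\<Sum>b\<in>B. \<Sum>a\<in>{a\<in>B. a < b}. (window_weight z R (2 * h) a b)\<^sup>2)"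
proof -
  have wt: "real h \<le> window_weight z R (2 * h) a b"
    if "a \<in> {z + 2 * int h - 1..<z + int R}" "b \<in> {a + 1..a + int h}" for a b
  proof -
    define p where "p = nat (a - z)"
    have p: "a = z + int p" "2 * h - 1 \<le> p" "p < R" using that h by (auto simp: p_def)
    \<comment> \<open>The windows starting at offsets \<open>p + 1 - h\<close> to \<open>p\<close>
      contain \<open>a\<close> and reach up to \<open>a + h\<close> at least.\<close>
    have "real h = (\<Sum>r\<in>{p + 1 - h..p}. 1)" using p h by simp
    also have "\<dots> \<le> (\<Sum>r<R. of_bool (z + int r \<le> a \<and> b < z + int r + int (2 * h)))"
    proof -
      have "(\<Sum>r\<in>{p + 1 - h..p}. 1::real) =
         (\<Sum>r\<in>{p + 1 - h..p}. of_bool (z + int r \<le> a \<and> b < z + int r + int (2 * h)))"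
        using that p h by (intro sum.cong) auto
      also have "\<dots> \<le> (\<Sum>r<R. of_bool (z + int r \<le> a \<and> b < z + int r + int (2 * h)))"
        using p by (intro sum_mono2) auto
      finally show ?thesis .
    qed
    finally show ?thesis by (simp add: window_weight_def)
  qed
  have fin: "finite {b\<in>B. a < b}" for a
    by (rule finite_subset[of _ B]) (auto simp: B_def)
  have "real (R + 1 - 2 * h) * real h ^ 3 =
      (\<Sum>a\<in>{z + 2 * int h - 1..<z + int R}. \<Sum>b\<in>{a + 1..a + int h}. (real h)\<^sup>2)"
    using h by (simp add: power2_eq_square power3_eq_cube of_nat_diff nat_diff_distrib algebra_simps)
  also have "\<dots> \<le> (\<Sum>a\<in>{z + 2 * int h - 1..<z + int R}. \<Sum>b\<in>{a + 1..a + int h}.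
      (window_weight z R (2 * h) a b)\<^sup>2)"
    by (intro sum_mono power_mono wt) auto
  also have "\<dots> \<le> (\<Sum>a\<in>{z + 2 * int h - 1..<z + int R}. \<Sum>b\<in>{b\<in>B. a < b}.
      (window_weight z R (2 * h) a b)\<^sup>2)"
    using h by (intro sum_mono sum_mono2 fin) (auto simp: B_def)
  also have "\<dots> \<le> (\<Sum>a\<in>B. \<Sum>b\<in>{b\<in>B. a < b}. (window_weight z R (2 * h) a b)\<^sup>2)"
    using h by (intro sum_mono2) (auto simp: B_def intro!: sum_nonneg)
  also have "\<dots> = (\<Sum>b\<in>B. \<Sum>a\<in>{a\<in>B. a < b}. (window_weight z R (2 * h) a b)\<^sup>2)"
    by (rule sum.swap_restrict) (auto simp: B_def)
  finally show ?thesis .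
qed

text \<open>\<open>\<tau>\<close> may be replaced by the standard deviation, which is at least as
  large: the coefficients are twice the window weights, whence the factor 4.\<close>

lemma window_squares_tail:
  fixes z :: int
  assumes h: "1 \<le> h" "2 * h \<le> R" and \<tau>: "\<tau>\<^sup>2 \<le> 4 * (real (R + 1 - 2 * h) * real h ^ 3)"
  shows "1 / 200 \<le> signs_exp {z..<z + int R + int (2 * h) - 1} (\<lambda>s. of_bool
     (\<tau> / 10 \<le> (\<Sum>r<R. (\<Sum>a\<in>{z + int r..<z + int r + int (2 * h)}. s a)\<^sup>2 - real (2 * h)))) t"
proof -
  define B where "B = {z..<z + int R + int (2 * h) - 1}"
  define c where "c = (\<lambda>a b. 2 * window_weight z R (2 * h) a b)"
  define V where "V = (\<Sum>b\<in>B. \<Sum>a\<in>{a\<in>B. a < b}. (c a b)\<^sup>2)"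
  have "V = 4 * (\<Sum>b\<in>B. \<Sum>a\<in>{a\<in>B. a < b}. (window_weight z R (2 * h) a b)\<^sup>2)"
    by (simp add: V_def c_def power_mult_distrib sum_distrib_left)
  then have V: "4 * (real (R + 1 - 2 * h) * real h ^ 3) \<le> V"
    using window_weight_sq_sum[OF h, of z] by (simp add: B_def)
  moreover have "0 < real (R + 1 - 2 * h) * real h ^ 3" using h by simp
  ultimately have V0: "0 < V" by linarith
  have fin: "finite B" by (simp add: B_def)
  note qm = quadratic_form_moments[OF fin, of c, folded V_def]
  have "1 / 200 \<le> signs_exp B (\<lambda>s. of_bool (sqrt V / 10 \<le> quadratic_form c B s)) t"
  proof (rule fourth_moment_tail[OF fin qm(1)])
    have "sqrt V ^ 4 = ((sqrt V)\<^sup>2)\<^sup>2" by simp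
    then show "signs_exp B (\<lambda>s. (quadratic_form c B s) ^ 4) t \<le> 27 * sqrt V ^ 4"
      using qm(3) V0 by simp
  qed (use V0 qm(2) in auto)
  also have "\<dots> \<le> signs_exp B (\<lambda>s. of_bool
     (\<tau> / 10 \<le> (\<Sum>r<R. (\<Sum>a\<in>{z + int r..<z + int r + int (2 * h)}. s a)\<^sup>2 - real (2 * h)))) t"
  proof (rule signs_exp_mono[OF fin])
    fix s :: "int \<Rightarrow> real" assume "\<forall>a\<in>B. s a = 1 \<or> s a = -1"
    then have "(\<Sum>r<R. (\<Sum>a\<in>{z + int r..<z + int r + int (2 * h)}. s a)\<^sup>2 - real (2 * h)) =
       quadratic_form c B s"
      unfolding B_def c_def by (rule window_squares_quadratic_form)
    moreover have "\<tau> \<le> sqrt V"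
      using \<tau> V by (intro real_le_rsqrt) simp
    ultimately show "of_bool (sqrt V / 10 \<le> quadratic_form c B s) \<le> (of_bool
     (\<tau> / 10 \<le> (\<Sum>r<R. (\<Sum>a\<in>{z + int r..<z + int r + int (2 * h)}. s a)\<^sup>2 - real (2 * h))) :: real)"
      by auto
  qed
  finally show ?thesis by (simp add: B_def)
qed

section \<open>Combining independent blocks\<close>

text \<open>The rows that belong to no block window are uncontrolled, but as \<open>w\<close> is
  nonnegative each of them costs at most \<open>k\<close>.\<close>

lemma sum_nat_blocks:
  fixes w :: "nat \<Rightarrow> real"
  assumes w: "\<And>i. 0 \<le> w i" and "R \<le> M" "G * M \<le> m" "0 \<le> k"
  shows "(\<Sum>g<G. \<Sum>r<R. w (g * M + r) - k) - k * (real m - real G * real R) \<le> (\<Sum>i<m. w i - k)"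
proof -
  let ?f = "\<lambda>(g, r). g * M + r"
  define S where "S = ?f ` ({..<G} \<times> {..<R})"
  have inj: "inj_on ?f ({..<G} \<times> {..<R})"
  proof (rule inj_onI, clarsimp)
    fix a b a' b' assume *: "a * M + b = a' * M + b'" "b < R" "b' < R"
    have "b = (a * M + b) mod M" using *(2) assms(2) by simp
    also have "\<dots> = (a' * M + b') mod M" by (simp only: *)
    also have "\<dots> = b'" using *(3) assms(2) by simp
    finally show "a = a' \<and> b = b'" using * assms(2) by auto
  qed
  have sub: "S \<subseteq> {..<m}"
  proof
    fix i assume "i \<in> S"
    then obtain g r where i: "i = g * M + r" "g < G" "r < R" by (auto simp: S_def)
    then have "i < Suc g * M" using assms(2) by simp
    also have "\<dots> \<le> G * M" using i(2) by (intro mult_right_mono) auto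
    finally show "i \<in> {..<m}" using assms(3) by simp
  qed
  have "card S = G * R" using inj by (simp add: S_def card_image)
  then have "real (card ({..<m} - S)) = real m - real G * real R"
    using sub by (subst card_Diff_subset) (auto simp: finite_subset of_nat_diff dest!: card_mono[rotated])
  then have "- (k * (real m - real G * real R)) = (\<Sum>i\<in>{..<m} - S. - k)" by simp
  also have "\<dots> \<le> (\<Sum>i\<in>{..<m} - S. w i - k)" using w by (intro sum_mono) simp
  finally have "- (k * (real m - real G * real R)) \<le> (\<Sum>i\<in>{..<m} - S. w i - k)" .
  moreover have "(\<Sum>i<m. w i - k) = (\<Sum>i\<in>S. w i - k) + (\<Sum>i\<in>{..<m} - S. w i - k)"
    using sub by (subst sum.subset_diff[of S]) auto
  moreover have "(\<Sum>i\<in>S. w i - k) = (\<Sum>g<G. \<Sum>r<R. w (g * M + r) - k)"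
    unfolding S_def by (subst sum.reindex[OF inj]) (simp add: sum.cartesian_product split_def)
  ultimately show ?thesis by linarith
qed

text \<open>A block of \<open>R\<close> windows reads exactly \<open>M\<close> signs, so the blocks
  are disjoint and all of them exceed their tail level together with probability at least
  \<open>(1 / 200) ^ G\<close>. The bound \<open>3200 * h \<le> M\<close> pays for the windows
  across blocks, the bound on \<open>\<epsilon>\<close> for the target.\<close>

lemma toeplitz_window_tail:
  fixes m n h G :: nat and \<epsilon> :: real
  defines "M \<equiv> m div G"
  assumes h: "1 \<le> h" "2 * h \<le> n" and G: "1 \<le> G" and M: "3200 * h \<le> M"
    and \<epsilon>: "0 \<le> \<epsilon>" "3200 * real M * \<epsilon>\<^sup>2 \<le> real h"
  shows "(1 / 200) ^ G \<le> signs_exp {- (int m - 1)..int n - 1} (\<lambda>s. of_bool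
     (real m * real (2 * h) * \<epsilon> \<le>
        (\<Sum>i<m. (\<Sum>a\<in>{- int i..<- int i + int (2 * h)}. s a)\<^sup>2 - real (2 * h)))) t"
proof -
  define R where "R = M + 1 - 2 * h"
  \<comment> \<open>Row \<open>i\<close> reads the window that starts at \<open>- i\<close>, so the rows of a block are traversed backwards.\<close>
  define z where "z = (\<lambda>g. - (int (g * M + R) - 1))"
  define B where "B = (\<lambda>g. {z g..<z g + int R + int (2 * h) - 1})"
  \<comment> \<open>The variance is at least \<open>4 * (R + 1 - 2 * h) * h ^ 3\<close>, and
    \<open>R + 1 - 2 * h\<close> is at least \<open>M / 2\<close>.\<close>
  define \<tau> where "\<tau> = sqrt (2 * real M * real h ^ 3)"
  define Q where "Q = (\<lambda>g s. \<Sum>r<R. (\<Sum>a\<in>{z g + int r..<z g + int r + int (2 * h)}. s a)\<^sup>2 - real (2 * h))"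
  define w where "w = (\<lambda>s i. (\<Sum>a\<in>{- int i..<- int i + int (2 * h)}. (s a :: real))\<^sup>2)"
  have R: "2 * h \<le> R" "R \<le> M" "R + 2 * h = M + 1" using M h by (auto simp: R_def)
  have GM: "G * M \<le> m" "m < G * M + G"
    using G dividend_less_div_times[of G m] unfolding M_def by (simp_all add: mult.commute)
  have Bend: "B g = {2 * int h - int (Suc g * M)..<2 * int h - int (g * M)}" for g
  proof -
    have "int R = int M + 1 - 2 * int h" using R(3) by linarith
    then show ?thesis
      unfolding B_def z_def of_nat_add of_nat_mult by (simp only:) (simp add: algebra_simps)
  qed
  have \<tau>2: "\<tau>\<^sup>2 = 2 * real M * real h ^ 3" by (simp add: \<tau>_def)
  have \<tau>0: "0 \<le> \<tau>" by (simp add: \<tau>_def)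
  have tail: "1 / 200 \<le> signs_exp (B g) (\<lambda>s. of_bool (\<tau> / 10 \<le> Q g s)) t" for g t
    unfolding B_def Q_def
  proof (rule window_squares_tail[OF h(1) R(1)])
    have "real M \<le> 2 * real (R + 1 - 2 * h)" using R M by linarith
    then have "real M * real h ^ 3 \<le> (2 * real (R + 1 - 2 * h)) * real h ^ 3"
      by (intro mult_right_mono) auto
    then show "\<tau>\<^sup>2 \<le> 4 * (real (R + 1 - 2 * h) * real h ^ 3)"
      by (simp add: \<tau>2 mult_ac)
  qed
  have "(1 / 200) ^ G \<le> signs_exp (\<Union>g<G. B g) (\<lambda>s. \<Prod>g<G. of_bool (\<tau> / 10 \<le> Q g s)) t" for t
  proof (rule signs_exp_prod_ge)
    fix g g' :: nat assume "g < g'" "g' < G"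
    then have "int (Suc g * M) \<le> int (g' * M)"
      by (intro zle_int[THEN iffD2] mult_right_mono) auto
    then show "B g \<inter> B g' = {}" unfolding Bend by auto
  next
    fix g and s s' :: "int \<Rightarrow> real" assume "\<forall>a\<in>B g. s a = s' a"
    then have "Q g s = Q g s'"
      unfolding Q_def B_def
      by (intro sum.cong refl arg_cong2[of _ _ _ _ "(-)"] arg_cong[of _ _ "\<lambda>x. x\<^sup>2"]) auto
    then show "of_bool (\<tau> / 10 \<le> Q g s) = (of_bool (\<tau> / 10 \<le> Q g s') :: real)" by simp
  qed (use tail in \<open>auto simp: B_def\<close>)
  moreover have "(\<Union>g<G. B g) \<subseteq> {- (int m - 1)..int n - 1}"
  proof
    fix x assume "x \<in> (\<Union>g<G. B g)"
    then obtain g where g: "g < G" and x: "2 * int h - int (Suc g * M) \<le> x" "x < 2 * int h - int (g * M)"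
      by (auto simp: Bend simp del: mult_Suc of_nat_mult)
    have "Suc g * M \<le> G * M" using g by (intro mult_right_mono) auto
    then have "int (Suc g * M) \<le> int m" using GM(1) by linarith
    moreover have "0 \<le> int (g * M)" by simp
    ultimately have "- (int m - 1) \<le> x" "x \<le> int n - 1" using x h by linarith+
    then show "x \<in> {- (int m - 1)..int n - 1}" by simp
  qed
  ultimately have "(1 / 200) ^ G \<le> signs_exp {- (int m - 1)..int n - 1}
      (\<lambda>s. \<Prod>g<G. of_bool (\<tau> / 10 \<le> Q g s)) t"
    by (rule signs_exp_superset_ge[OF finite_atLeastAtMost_int, rotated])
  also have "\<dots> \<le> signs_exp {- (int m - 1)..int n - 1} (\<lambda>s. of_bool
     (real m * real (2 * h) * \<epsilon> \<le> (\<Sum>i<m. w s i - real (2 * h)))) t"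
  proof (rule signs_exp_mono)
    fix s :: "int \<Rightarrow> real"
    show "(\<Prod>g<G. of_bool (\<tau> / 10 \<le> Q g s)) \<le>
      (of_bool (real m * real (2 * h) * \<epsilon> \<le> (\<Sum>i<m. w s i - real (2 * h))) :: real)"
    proof (cases "\<forall>g<G. \<tau> / 10 \<le> Q g s")
      case False
      then have "(\<Prod>g<G. of_bool (\<tau> / 10 \<le> Q g s)) = (0::real)" by (intro prod_zero) auto
      then show ?thesis by (simp only:) simp
    next
      case True
      have Qw: "Q g s = (\<Sum>r<R. w s (g * M + r) - real (2 * h))" for g
      proof -
        have "Q g s = (\<Sum>r<R. w s (g * M + (R - Suc r)) - real (2 * h))"
          unfolding Q_def w_def
        proof (intro sum.cong refl)
          fix r assume "r \<in> {..<R}"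
          then have "z g + int r = - int (g * M + (R - Suc r))"
            by (simp add: z_def of_nat_diff)
          then show "(\<Sum>a\<in>{z g + int r..<z g + int r + int (2 * h)}. s a)\<^sup>2 - real (2 * h) =
            (\<Sum>a\<in>{- int (g * M + (R - Suc r))..<- int (g * M + (R - Suc r)) + int (2 * h)}. s a)\<^sup>2 - real (2 * h)"
            by simp
        qed
        also have "\<dots> = (\<Sum>r<R. w s (g * M + r) - real (2 * h))"
          by (rule sum.nat_diff_reindex)
        finally show ?thesis .
      qed
      have "real G * (\<tau> / 10) = (\<Sum>g<G. \<tau> / 10)" by simp
      also have "\<dots> \<le> (\<Sum>g<G. Q g s)" using True by (intro sum_mono) auto
      finally have Qsum: "real G * (\<tau> / 10) \<le> (\<Sum>g<G. \<Sum>r<R. w s (g * M + r) - real (2 * h))"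
        by (simp add: Qw)
      \<comment> \<open>Each block loses \<open>2 * h - 1\<close> rows to windows across its border,
        and fewer than \<open>G\<close> rows remain after the last block.\<close>
      have "real m - real G * real R \<le> real G * real (2 * h)"
      proof -
        have "real m \<le> real G * real M + real G" using GM(2) by (simp flip: of_nat_mult of_nat_add)
        moreover have Rr: "real R = real M + 1 - real (2 * h)" using R(3) by linarith
        have "real G * real R = real G * real M + real G - real G * real (2 * h)"
          unfolding Rr by (simp only: ring_distribs mult_1_right)
        ultimately show ?thesis by linarith
      qed
      then have "real (2 * h) * (real m - real G * real R) \<le> real (2 * h) * (real G * real (2 * h))"
        by (intro mult_left_mono) auto
      then have bad: "real (2 * h) * (real m - real G * real R) \<le> real G * (4 * (real h)\<^sup>2)"
        by (simp add: power2_eq_square)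
      \<comment> \<open>\<open>\<tau> / 10\<close> is split into two halves: this one covers the
        uncontrolled rows, the next one the target.\<close>
      have "80 * (real h)\<^sup>2 \<le> \<tau>"
      proof (rule power2_le_imp_le[OF _ \<tau>0])
        have "(80 * (real h)\<^sup>2)\<^sup>2 = 2 * real (3200 * h) * real h ^ 3"
          by (simp add: power2_eq_square power3_eq_cube)
        also have "\<dots> \<le> 2 * real M * real h ^ 3"
          using M by (intro mult_mono) (auto simp del: of_nat_mult)
        finally show "(80 * (real h)\<^sup>2)\<^sup>2 \<le> \<tau>\<^sup>2" by (simp add: \<tau>2)
      qed
      moreover have "80 * (real M * real h * \<epsilon>) \<le> \<tau>"
      proof (rule power2_le_imp_le[OF _ \<tau>0])
        have "(80 * (real M * real h * \<epsilon>))\<^sup>2 = (2 * real M * (real h)\<^sup>2) * (3200 * real M * \<epsilon>\<^sup>2)"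
          by (simp add: power2_eq_square)
        also have "\<dots> \<le> (2 * real M * (real h)\<^sup>2) * real h"
          using \<epsilon> by (intro mult_left_mono) auto
        finally show "(80 * (real M * real h * \<epsilon>))\<^sup>2 \<le> \<tau>\<^sup>2"
          unfolding \<tau>2 by (simp add: power2_eq_square power3_eq_cube mult_ac)
      qed
      ultimately have "4 * (real h)\<^sup>2 + 4 * (real M * real h * \<epsilon>) \<le> \<tau> / 10" by simp
      then have "real G * (4 * (real h)\<^sup>2 + 4 * (real M * real h * \<epsilon>)) \<le> real G * (\<tau> / 10)"
        by (intro mult_left_mono) auto
      moreover have "real m * real (2 * h) * \<epsilon> \<le> real G * (4 * (real M * real h * \<epsilon>))"
      proof -
        have "G * 1 \<le> G * M" using M h by (intro mult_left_mono) auto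
        then have "real m \<le> 2 * real (G * M)" using GM(2) by linarith
        then have "real m * (real (2 * h) * \<epsilon>) \<le> (2 * real (G * M)) * (real (2 * h) * \<epsilon>)"
          using \<epsilon> by (intro mult_right_mono) auto
        then show ?thesis by (simp add: mult_ac)
      qed
      ultimately have "real m * real (2 * h) * \<epsilon> \<le>
          real G * (\<tau> / 10) - real (2 * h) * (real m - real G * real R)"
        using bad unfolding distrib_left by linarith
      also have "\<dots> \<le> (\<Sum>i<m. w s i - real (2 * h))"
      proof -
        have "(\<Sum>g<G. \<Sum>r<R. w s (g * M + r) - real (2 * h)) -
            real (2 * h) * (real m - real G * real R) \<le> (\<Sum>i<m. w s i - real (2 * h))"
          using R GM by (intro sum_nat_blocks) (auto simp: w_def)
        then show ?thesis using Qsum by linarith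
      qed
      finally show ?thesis by (auto intro!: prod_le_1)
    qed
  qed simp
  finally show ?thesis by (simp add: w_def)
qed

text \<open>The exponent consists of \<open>3202 * h\<close> for an event about \<open>t\<close> and
  \<open>2 * h\<close> for the event that \<open>d\<close> is 1 on the support of
  \<open>x\<close>.\<close>

lemma large_deviation:
  fixes m n h :: nat and \<epsilon> :: real
  assumes h: "1 \<le> h" "2 * h \<le> n" and m: "1 \<le> m"
    and \<epsilon>: "0 < \<epsilon>" "\<epsilon> < 1 / 5000" "3200 * (real m * \<epsilon>\<^sup>2) \<le> (real h)\<^sup>2"
  obtains x where "x \<in> carrier_vec n" "euclidean_norm x = 1"
    "measure_pmf.prob (signs_pmf m n)
       {s. \<bar>(euclidean_norm (hv_embedding m n s x))\<^sup>2 - 1\<bar> < \<epsilon>} \<le> 1 - (1 / 2) ^ (3204 * h)"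
proof
  define x where "x = vec n (\<lambda>j. if j < 2 * h then 1 / sqrt (real (2 * h)) else 0)"
  define I where "I = {- (int m - 1)..int n - 1}"
  define Y where "Y = (\<lambda>s. \<Sum>i<m. (\<Sum>a\<in>{- int i..<- int i + int (2 * h)}. s a)\<^sup>2 - real (2 * h))"
  let ?X = "\<lambda>s. (euclidean_norm (hv_embedding m n s x))\<^sup>2 - 1"
  have k0: "0 < real (2 * h)" using h by simp
  show xc: "x \<in> carrier_vec n" by (simp add: x_def)
  have "(\<Sum>j<n. (x $ j)\<^sup>2) = (\<Sum>j<n. if j < 2 * h then 1 / real (2 * h) else 0)"
    by (intro sum.cong) (auto simp: x_def power_divide)
  also have "\<dots> = (\<Sum>j<2 * h. 1 / real (2 * h))"
    using h by (intro sum.mono_neutral_cong_right) auto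
  also have "\<dots> = 1" using k0 by simp
  finally show "euclidean_norm x = 1"
    by (simp add: euclidean_norm_def L2_set_def x_def)
  have norm: "?X (t, d) = Y t / (real m * real (2 * h))" if d: "\<forall>j<2 * h. d j = 1" for t d
  proof -
    have row: "(\<Sum>j<n. t (int j - int i) * d j * x $ j)\<^sup>2 =
        (\<Sum>a\<in>{- int i..<- int i + int (2 * h)}. t a)\<^sup>2 / real (2 * h)" for i
    proof -
      have "(\<Sum>j<n. t (int j - int i) * d j * x $ j) = (\<Sum>j<2 * h. t (int j - int i) / sqrt (real (2 * h)))"
        using h d by (intro sum.mono_neutral_cong_right) (auto simp: x_def)
      also have "\<dots> = (\<Sum>j<2 * h. t (int j - int i)) / sqrt (real (2 * h))"
        by (simp add: sum_divide_distrib)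
      also have "(\<Sum>j<2 * h. t (int j - int i)) = (\<Sum>a\<in>{- int i..<- int i + int (2 * h)}. t a)"
        by (rule sum.reindex_bij_witness[of _ "\<lambda>a. nat (a + int i)" "\<lambda>j. int j - int i"]) auto
      finally show ?thesis by (simp add: power_divide)
    qed
    have "?X (t, d) = (\<Sum>i<m. (\<Sum>a\<in>{- int i..<- int i + int (2 * h)}. t a)\<^sup>2 / real (2 * h)) / real m - 1"
      by (simp only: hv_embedding_norm[OF xc] row)
    also have "\<dots> = ((\<Sum>i<m. (\<Sum>a\<in>{- int i..<- int i + int (2 * h)}. t a)\<^sup>2) - real m * real (2 * h)) / (real m * real (2 * h))"
      using m k0 by (simp add: field_simps flip: sum_divide_distrib)
    also have "\<dots> = Y t / (real m * real (2 * h))"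
      by (simp add: Y_def sum_subtractf)
    finally show ?thesis .
  qed
  have main: "(1 / 2) ^ (3202 * h) \<le> signs_exp I (\<lambda>s. of_bool (real m * real (2 * h) * \<epsilon> \<le> Y s)) t" for t
  proof (cases "m < 3200 * h")
    case True
    \<comment> \<open>\<open>J\<close> contains all entries that the rows read, fewer than
      \<open>3202 * h\<close> of them. If all are 1, the distortion is \<open>2 * h - 1\<close>,
      which is at least 1.\<close>
    define J where "J = {- (int m - 1)..int (2 * h) - 1}"
    have "(1 / 2) ^ (3202 * h) \<le> (1 / 2 :: real) ^ card J"
      using True m by (intro power_decreasing) (auto simp: J_def)
    also have "\<dots> \<le> signs_exp I (\<lambda>s. of_bool (\<forall>a\<in>J. s a = 1)) t"
      using h by (intro signs_exp_superset_ge[of I J, OF _ _ eq_refl[OF signs_exp_all_ones[symmetric]]])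
        (auto simp: I_def J_def)
    also have "\<dots> \<le> signs_exp I (\<lambda>s. of_bool (real m * real (2 * h) * \<epsilon> \<le> Y s)) t"
    proof (rule signs_exp_mono)
      fix s :: "int \<Rightarrow> real"
      have "real m * real (2 * h) * \<epsilon> \<le> Y s" if "\<forall>a\<in>J. s a = 1"
      proof -
        have "(\<Sum>a\<in>{- int i..<- int i + int (2 * h)}. s a) = real (2 * h)" if "i < m" for i
        proof -
          have "(\<Sum>a\<in>{- int i..<- int i + int (2 * h)}. s a) = (\<Sum>a\<in>{- int i..<- int i + int (2 * h)}. 1)"
            using \<open>\<forall>a\<in>J. s a = 1\<close> that by (intro sum.cong) (auto simp: J_def)
          then show ?thesis by simp
        qed
        then have "Y s = real m * ((real (2 * h))\<^sup>2 - real (2 * h))"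
          by (simp add: Y_def)
        also have "\<dots> = real m * real (2 * h) * (real (2 * h) - 1)"
          by (simp add: power2_eq_square algebra_simps)
        finally have "Y s = real m * real (2 * h) * (real (2 * h) - 1)" .
        moreover have "real m * real (2 * h) * \<epsilon> \<le> real m * real (2 * h) * (real (2 * h) - 1)"
          using h \<epsilon> by (intro mult_left_mono) auto
        ultimately show ?thesis by linarith
      qed
      then show "of_bool (\<forall>a\<in>J. s a = 1) \<le> (of_bool (real m * real (2 * h) * \<epsilon> \<le> Y s) :: real)"
        by auto
    qed (simp add: I_def)
    finally show ?thesis .
  next
    case False
    \<comment> \<open>As many blocks of length at least \<open>3200 * h\<close> as fit, but at most
      \<open>h\<close> of them, to keep the probability large.\<close>
    define G where "G = min h (m div (3200 * h))"
    define M where "M = m div G"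
    have G1: "1 \<le> G"
      using False h by (simp add: G_def Suc_le_eq div_greater_zero_iff)
    have "G * (3200 * h) \<le> m"
      using mult_right_mono[of G "m div (3200 * h)" "3200 * h"] div_times_less_eq_dividend[of m "3200 * h"]
      unfolding G_def by linarith
    then have M: "3200 * h \<le> M"
      using G1 by (simp add: M_def less_eq_div_iff_mult_less_eq mult.commute)
    have GM: "real G * real M \<le> real m"
      unfolding M_def by (simp flip: of_nat_mult)
    \<comment> \<open>With \<open>h\<close> blocks this is the assumption on
      \<open>m * \<epsilon>\<^sup>2\<close>. With fewer blocks \<open>M\<close> is at most
      \<open>6400 * h\<close>, and \<open>\<epsilon> < 1 / 5000\<close> suffices.\<close>
    have Me: "3200 * real M * \<epsilon>\<^sup>2 \<le> real h"
    proof (cases "G = h")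
      case True
      have "real h * (3200 * real M * \<epsilon>\<^sup>2) = 3200 * (real G * real M * \<epsilon>\<^sup>2)"
        by (simp add: True)
      also have "\<dots> \<le> 3200 * (real m * \<epsilon>\<^sup>2)"
        using GM by (intro mult_left_mono mult_right_mono) auto
      also have "\<dots> \<le> real h * real h" using \<epsilon> by (simp add: power2_eq_square)
      finally show ?thesis using h by simp
    next
      case False
      then have G: "G = m div (3200 * h)" by (simp add: G_def)
      have "G * M \<le> m" by (simp add: M_def)
      also have "m < 3200 * h + G * (3200 * h)"
        using h dividend_less_div_times[of "3200 * h" m] by (simp add: G)
      also have "\<dots> \<le> G * (6400 * h)" using G1 by (cases G) auto
      finally have "M \<le> 6400 * h" by simp
      then have "real M \<le> 6400 * real h" by linarith
      then have "3200 * real M * \<epsilon>\<^sup>2 \<le> 3200 * (6400 * real h) * (1 / 5000)\<^sup>2"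
        using \<epsilon> by (intro mult_mono power_mono) auto
      also have "\<dots> \<le> real h" by (simp add: power2_eq_square)
      finally show ?thesis .
    qed
    \<comment> \<open>\<open>2 ^ 8 = 256\<close> exceeds 200, and \<open>G \<le> h\<close>.\<close>
    have "(1 / 2) ^ (3202 * h) \<le> (1 / 2 :: real) ^ (8 * G)"
      by (intro power_decreasing) (auto simp: G_def)
    also have "\<dots> = ((1 / 2) ^ 8) ^ G" by (simp add: power_mult)
    also have "\<dots> \<le> (1 / 200) ^ G" by (intro power_mono) (simp_all add: power_divide)
    also have "\<dots> \<le> signs_exp I (\<lambda>s. of_bool (real m * real (2 * h) * \<epsilon> \<le> Y s)) t"
      unfolding I_def Y_def using h G1 M Me \<epsilon> unfolding M_def
      by (intro toeplitz_window_tail) auto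
    finally show ?thesis .
  qed
  have event: "(1 / 2) ^ (3202 * h) * of_bool (\<forall>j\<in>{..<2 * h}. d j = 1) \<le>
      signs_exp I (\<lambda>t. of_bool (\<epsilon> \<le> \<bar>?X (t, d)\<bar>)) (\<lambda>_. 0)" for d
  proof (cases "\<forall>j\<in>{..<2 * h}. d j = 1")
    case True
    have "(1 / 2) ^ (3202 * h) \<le> signs_exp I (\<lambda>s. of_bool (real m * real (2 * h) * \<epsilon> \<le> Y s)) (\<lambda>_. 0)"
      by (rule main)
    also have "\<dots> \<le> signs_exp I (\<lambda>t. of_bool (\<epsilon> \<le> \<bar>?X (t, d)\<bar>)) (\<lambda>_. 0)"
    proof (rule signs_exp_mono)
      fix s
      have "\<epsilon> \<le> ?X (s, d)" if "real m * real (2 * h) * \<epsilon> \<le> Y s"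
        using that True m k0 by (subst norm) (auto simp: field_simps)
      then show "of_bool (real m * real (2 * h) * \<epsilon> \<le> Y s) \<le> (of_bool (\<epsilon> \<le> \<bar>?X (s, d)\<bar>) :: real)"
        by force
    qed (simp add: I_def)
    finally show ?thesis using True by simp
  qed (auto intro!: signs_exp_nonneg simp: I_def)
  have "(1 / 2) ^ (3204 * h) = (1 / 2) ^ (3202 * h) * (1 / 2 :: real) ^ (2 * h)"
    by (simp flip: power_add)
  also have "\<dots> \<le> (1 / 2) ^ (3202 * h) * signs_exp {..<n} (\<lambda>d. of_bool (\<forall>j\<in>{..<2 * h}. d j = 1)) (\<lambda>_. 0)"
    using h signs_exp_all_ones[of "{..<2 * h}"]
    by (intro mult_left_mono signs_exp_superset_ge[of "{..<n}" "{..<2 * h}"]) simp_all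
  also have "\<dots> = signs_exp {..<n} (\<lambda>d. (1 / 2) ^ (3202 * h) * of_bool (\<forall>j\<in>{..<2 * h}. d j = 1)) (\<lambda>_. 0)"
    by (rule signs_exp_cmult[symmetric]) simp
  also have "\<dots> \<le> signs_exp {..<n} (\<lambda>d. signs_exp I (\<lambda>t. of_bool (\<epsilon> \<le> \<bar>?X (t, d)\<bar>)) (\<lambda>_. 0)) (\<lambda>_. 0)"
    by (intro signs_exp_mono event) simp
  also have "\<dots> = measure_pmf.prob (signs_pmf m n) {s. \<epsilon> \<le> \<bar>?X s\<bar>}"
    unfolding I_def by (rule prob_signs_pmf[symmetric])
  finally show "measure_pmf.prob (signs_pmf m n) {s. \<bar>?X s\<bar> < \<epsilon>} \<le> 1 - (1 / 2) ^ (3204 * h)"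
    by (rule prob_less_le_complement)
qed

section \<open>The Littlewood--Offord inequality\<close>

text \<open>
  The probability that the simple random walk is in \<open>{-k..<k}\<close> after \<open>n\<close> steps.
\<close>
definition walk_window :: "nat \<Rightarrow> nat \<Rightarrow> real" where
  "walk_window n k =
     (\<Sum>j\<le>n. real (n choose j) * of_bool (- int k \<le> 2 * int j - int n \<and> 2 * int j - int n < int k)) / 2 ^ n"

lemma sum_choose_Suc:
  fixes f :: "nat \<Rightarrow> real"
  shows "(\<Sum>j\<le>Suc n. real (Suc n choose j) * f j) =
     (\<Sum>j\<le>n. real (n choose j) * f j) + (\<Sum>j\<le>n. real (n choose j) * f (Suc j))"
proof -
  have "(\<Sum>j\<le>Suc n. real (Suc n choose j) * f j) =
      f 0 + (\<Sum>j\<le>n. real (n choose j) * f (Suc j)) + (\<Sum>j\<le>n. real (n choose Suc j) * f (Suc j))"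
    by (subst sum.atMost_Suc_shift) (simp add: sum.distrib algebra_simps)
  moreover have "f 0 + (\<Sum>j\<le>n. real (n choose Suc j) * f (Suc j)) = (\<Sum>j\<le>Suc n. real (n choose j) * f j)"
    by (subst sum.atMost_Suc_shift) simp
  moreover have "\<dots> = (\<Sum>j\<le>n. real (n choose j) * f j)" by simp
  ultimately show ?thesis by linarith
qed

text \<open>One step shifts the window by 1 to either side. The union of the two shifts is the
  window for \<open>k + 1\<close> and their intersection the one for \<open>k - 1\<close>.\<close>

lemma walk_window_Suc:
  assumes "1 \<le> k"
  shows "walk_window (Suc n) k = (walk_window n (k + 1) + walk_window n (k - 1)) / 2"
proof -
  let ?w = "\<lambda>c z. of_bool (- int c \<le> z \<and> z < int c) :: real"
  have "(\<Sum>j\<le>n. real (n choose j) * ?w k (2 * int j - int (Suc n))) +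
      (\<Sum>j\<le>n. real (n choose j) * ?w k (2 * int (Suc j) - int (Suc n))) =
      (\<Sum>j\<le>n. real (n choose j) * ?w (k + 1) (2 * int j - int n)) +
      (\<Sum>j\<le>n. real (n choose j) * ?w (k - 1) (2 * int j - int n))"
    unfolding sum.distrib[symmetric] distrib_left[symmetric]
    using assms by (intro sum.cong refl arg_cong2[of _ _ _ _ "(*)"]) (auto simp: of_nat_diff)
  then show ?thesis
    unfolding walk_window_def by (subst sum_choose_Suc) (simp add: field_simps)
qed

text \<open>From \<open>a\<close> to \<open>Suc a\<close> the left-hand side is multiplied by
  \<open>4 * (2 * a + 1) * (2 * a + 3) / (a + 1)\<^sup>2\<close>, which is at most 16.\<close>

lemma central_binomial_sq_le: "(real ((2 * a) choose a))\<^sup>2 * real (2 * a + 1) \<le> 16 ^ a"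
proof (induction a)
  case (Suc a)
  define u v where "u = real ((2 * a) choose a)" and "v = real ((2 * Suc a) choose Suc a)"
  have "(2 * a + 1) choose Suc a = (2 * a + 1) choose a"
    using binomial_symmetric[of a "2 * a + 1"] by simp
  then have e1: "Suc a * ((2 * a + 1) choose a) = (2 * a + 1) * ((2 * a) choose a)"
    using Suc_times_binomial_eq[of "2 * a" a] by (simp add: mult.commute)
  have e2: "Suc a * ((2 * Suc a) choose Suc a) = (2 * Suc a) * ((2 * a + 1) choose a)"
    using Suc_times_binomial_eq[of "2 * a + 1" a] by (simp add: mult.commute)
  have "Suc a * (Suc a * ((2 * Suc a) choose Suc a)) = (2 * Suc a) * (Suc a * ((2 * a + 1) choose a))"
    unfolding e2 by (simp only: mult_ac)
  also have "\<dots> = Suc a * (2 * ((2 * a + 1) * ((2 * a) choose a)))"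
    unfolding e1 by (simp only: mult_ac)
  finally have "Suc a * (Suc a * ((2 * Suc a) choose Suc a)) =
    Suc a * (2 * ((2 * a + 1) * ((2 * a) choose a)))" .
  then have "Suc a * ((2 * Suc a) choose Suc a) = 2 * ((2 * a + 1) * ((2 * a) choose a))"
    by (simp only: mult_cancel1) simp
  then have "real (Suc a * ((2 * Suc a) choose Suc a)) = real (2 * ((2 * a + 1) * ((2 * a) choose a)))"
    by (simp only:)
  then have "real (Suc a) * v = 2 * real (2 * a + 1) * u"
    unfolding u_def v_def of_nat_mult by simp
  then have "(real (Suc a) * v)\<^sup>2 = (2 * real (2 * a + 1) * u)\<^sup>2"
    by (simp only:)
  then have sq: "(real (Suc a))\<^sup>2 * v\<^sup>2 = 4 * (real (2 * a + 1))\<^sup>2 * u\<^sup>2"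
    by (simp only: power_mult_distrib) simp
  have "(real (Suc a))\<^sup>2 * (v\<^sup>2 * real (2 * Suc a + 1)) =
     ((real (Suc a))\<^sup>2 * v\<^sup>2) * real (2 * a + 3)"
    by simp
  also have "\<dots> = (4 * real (2 * a + 1) * real (2 * a + 3)) * (u\<^sup>2 * real (2 * a + 1))"
    unfolding sq by (simp only: power2_eq_square mult_ac)
  also have "\<dots> \<le> (16 * (real (Suc a))\<^sup>2) * 16 ^ a"
  proof (rule mult_mono)
    show "4 * real (2 * a + 1) * real (2 * a + 3) \<le> 16 * (real (Suc a))\<^sup>2"
      by (simp add: power2_eq_square algebra_simps)
    show "u\<^sup>2 * real (2 * a + 1) \<le> 16 ^ a" unfolding u_def by (rule Suc)
  qed auto
  also have "\<dots> = (real (Suc a))\<^sup>2 * 16 ^ Suc a" by simp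
  finally have "v\<^sup>2 * real (2 * Suc a + 1) \<le> 16 ^ Suc a"
    by (rule mult_left_le_imp_le) simp
  then show ?case by (simp add: v_def)
qed simp

lemma binomial_half_le: "real (n choose (n div 2)) \<le> 2 ^ n / sqrt (real (n + 1))"
proof -
  have "(real (n choose (n div 2)))\<^sup>2 * real (n + 1) \<le> (2 ^ n)\<^sup>2"
  proof (cases "even n")
    case True
    then obtain a where n: "n = 2 * a" by (auto elim: evenE)
    have "(2 ^ n)\<^sup>2 = (16 :: real) ^ a"
      by (simp add: n power_mult flip: power_mult_distrib) (simp add: power2_eq_square flip: power_mult_distrib)
    then show ?thesis using central_binomial_sq_le[of a] by (simp add: n)
  next
    case False
    then obtain a where n: "n = 2 * a + 1" by (auto elim: oddE)
    \<comment> \<open>For odd \<open>n\<close> the central coefficient is half of the one for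
      \<open>n + 1\<close>.\<close>
    have "Suc a * ((2 * Suc a) choose Suc a) = Suc a * (2 * ((2 * a + 1) choose a))"
      using Suc_times_binomial_eq[of "2 * a + 1" a] by (simp add: mult.commute)
    then have "(2 * Suc a) choose Suc a = 2 * ((2 * a + 1) choose a)"
      by (simp only: mult_cancel1) simp
    then have "(2 * real ((2 * a + 1) choose a))\<^sup>2 * real (2 * Suc a + 1) \<le> 16 ^ Suc a"
      using central_binomial_sq_le[of "Suc a"] by (metis of_nat_mult of_nat_numeral)
    then have "(real ((2 * a + 1) choose a))\<^sup>2 * real (2 * Suc a + 1) \<le> 4 * 16 ^ a"
      by (simp add: power_mult_distrib mult.commute)
    moreover have "(real ((2 * a + 1) choose a))\<^sup>2 * real (n + 1) \<le>
       (real ((2 * a + 1) choose a))\<^sup>2 * real (2 * Suc a + 1)"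
      by (intro mult_left_mono) (auto simp: n)
    moreover have "(2 ^ n)\<^sup>2 = 4 * (16 :: real) ^ a"
      by (simp add: n power_mult power_mult_distrib) (simp add: power2_eq_square flip: power_mult_distrib)
    ultimately have "(real ((2 * a + 1) choose a))\<^sup>2 * real (n + 1) \<le> (2 ^ n)\<^sup>2" by linarith
    moreover have "n div 2 = a" by (simp add: n)
    ultimately show ?thesis unfolding n by (simp only:)
  qed
  then have "(real (n choose (n div 2)) * sqrt (real (n + 1)))\<^sup>2 \<le> (2 ^ n)\<^sup>2"
    by (simp add: power_mult_distrib)
  then have "real (n choose (n div 2)) * sqrt (real (n + 1)) \<le> 2 ^ n"
    by (rule power2_le_imp_le) simp
  then show ?thesis by (simp add: field_simps)
qed

lemma walk_window_1_le: "walk_window n 1 \<le> 1 / sqrt (real (n + 1))"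
proof -
  \<comment> \<open>\<open>{-1..<1}\<close> contains one integer of the parity of
    \<open>n\<close>.\<close>
  have "(\<Sum>j\<le>n. real (n choose j) * of_bool (- int 1 \<le> 2 * int j - int n \<and> 2 * int j - int n < int 1)) =
     (\<Sum>j\<in>{n div 2}. real (n choose j))"
    by (intro sum.mono_neutral_cong_right) (auto simp del: sum_mult_of_bool_eq)
  then have "walk_window n 1 = real (n choose (n div 2)) / 2 ^ n"
    unfolding walk_window_def by simp
  also have "\<dots> \<le> (2 ^ n / sqrt (real (n + 1))) / 2 ^ n"
    by (intro divide_right_mono binomial_half_le) simp
  finally show ?thesis by simp
qed

lemma walk_window_nonneg: "0 \<le> walk_window n k"
  unfolding walk_window_def by (intro divide_nonneg_nonneg sum_nonneg) auto

definition in_cells :: "real set \<Rightarrow> real \<Rightarrow> bool" where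
  "in_cells P x \<longleftrightarrow> (\<exists>p\<in>P. p \<le> x \<and> x < p + 2)"

text \<open>
  Erdos' bound for a union of 2-separated cells of length 2. Integrating out one sign shifts the
  cells by \<open>\<plusminus>\<beta>\<close>. As \<open>\<beta> \<ge> 1\<close>, the leftmost cell of the copy shifted to the left can be moved to the other
  copy, which turns two families of \<open>k\<close> cells into families of \<open>k + 1\<close> and \<open>k - 1\<close> cells: the
  recursion of \<open>walk_window\<close>.
\<close>
lemma Littlewood_Offord_cells:
  fixes b :: "'i \<Rightarrow> real"
  assumes "finite A" "\<And>i. i \<in> A \<Longrightarrow> 1 \<le> \<bar>b i\<bar>"
    and "finite P" "\<And>p p'. p \<in> P \<Longrightarrow> p' \<in> P \<Longrightarrow> p < p' \<Longrightarrow> p + 2 \<le> p'"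
  shows "signs_exp A (\<lambda>s. of_bool (in_cells P (\<Sum>i\<in>A. b i * s i))) t \<le> walk_window (card A) (card P)"
  using assms
proof (induction A arbitrary: P t rule: finite_induct)
  case empty
  then show ?case by (auto simp: in_cells_def walk_window_def card_gt_0_iff)
next
  case (insert a A)
  let ?S = "\<lambda>s. \<Sum>i\<in>A. b i * s i"
  define \<beta> where "\<beta> = \<bar>b a\<bar>"
  have \<beta>: "1 \<le> \<beta>" using insert.prems(1) by (simp add: \<beta>_def)
  show ?case
  proof (cases "P = {}")
    case True
    have "signs_exp (insert a A) (\<lambda>s. of_bool (in_cells P (\<Sum>i\<in>insert a A. b i * s i))) t = 0"
      using insert.hyps True by (simp add: in_cells_def)
    then show ?thesis by (simp add: walk_window_nonneg)
  next
    case False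
    define p0 where "p0 = Min P"
    have p0: "p0 \<in> P" "\<And>p. p \<in> P \<Longrightarrow> p0 \<le> p"
      using False insert.prems(2) by (auto simp: p0_def)
    define P1 where "P1 = insert (p0 - \<beta>) ((\<lambda>p. p + \<beta>) ` P)"
    define P2 where "P2 = (\<lambda>p. p - \<beta>) ` (P - {p0})"
    have fin: "finite P1" "finite P2" using insert.prems(2) by (auto simp: P1_def P2_def)
    have new: "p0 - \<beta> \<notin> (\<lambda>p. p + \<beta>) ` P" using p0(2) \<beta> by force
    have card: "card P1 = card P + 1" "card P2 = card P - 1" "1 \<le> card P"
      using insert.prems(2) new p0(1) False
      by (auto simp: P1_def P2_def card_image inj_on_def Suc_le_eq card_gt_0_iff)
    \<comment> \<open>The moved cell starts at least \<open>2 * \<beta> \<ge> 2\<close> to the left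
      of the copy shifted to the right.\<close>
    have sep1: "p + 2 \<le> p'" if "p \<in> P1" "p' \<in> P1" "p < p'" for p p'
      using that insert.prems(3) p0(2) \<beta> unfolding P1_def by fastforce
    have sep2: "p + 2 \<le> p'" if "p \<in> P2" "p' \<in> P2" "p < p'" for p p'
      using that insert.prems(3) unfolding P2_def by fastforce
    have upd: "(\<Sum>i\<in>insert a A. b i * (s(a := y)) i) = ?S s + b a * y" for s y
    proof -
      have "(\<Sum>i\<in>A. b i * (s(a := y)) i) = ?S s"
        using insert.hyps by (intro sum.cong) auto
      then show ?thesis using insert.hyps by simp
    qed
    have ptw: "of_bool (in_cells P (x + \<beta>)) + of_bool (in_cells P (x - \<beta>)) \<le>
        (of_bool (in_cells P1 x) + of_bool (in_cells P2 x) :: real)" for x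
    proof -
      have "in_cells P2 x \<or> (p0 - \<beta> \<le> x \<and> x < p0 - \<beta> + 2)" if "in_cells P (x + \<beta>)"
      proof -
        obtain p where p: "p \<in> P" "p \<le> x + \<beta>" "x + \<beta> < p + 2" using \<open>in_cells P (x + \<beta>)\<close> by (auto simp: in_cells_def)
        show ?thesis
        proof (cases "p = p0")
          case False
          then have "p - \<beta> \<in> P2" using p(1) by (auto simp: P2_def)
          then show ?thesis using p unfolding in_cells_def by (intro disjI1 bexI[of _ "p - \<beta>"]) auto
        qed (use p in auto)
      qed
      \<comment> \<open>As the moved cell is excluded here, a point of both shifted copies lies in
        \<open>P1\<close> and in \<open>P2\<close>.\<close>
      moreover have "in_cells P1 x \<and> \<not> (p0 - \<beta> \<le> x \<and> x < p0 - \<beta> + 2)" if "in_cells P (x - \<beta>)"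
      proof -
        obtain p where p: "p \<in> P" "p \<le> x - \<beta>" "x - \<beta> < p + 2" using \<open>in_cells P (x - \<beta>)\<close> by (auto simp: in_cells_def)
        then have "p + \<beta> \<in> P1" "p + \<beta> \<le> x" "x < p + \<beta> + 2" by (auto simp: P1_def)
        then have "in_cells P1 x" unfolding in_cells_def by blast
        then show ?thesis using p p0(2)[OF p(1)] \<beta> by auto
      qed
      moreover have "in_cells P1 x" if "p0 - \<beta> \<le> x \<and> x < p0 - \<beta> + 2"
        using that unfolding in_cells_def P1_def by blast
      ultimately show ?thesis by (auto simp: of_bool_def)
    qed
    have "signs_exp (insert a A) (\<lambda>s. of_bool (in_cells P (\<Sum>i\<in>insert a A. b i * s i))) t =
       signs_exp A (\<lambda>s. (of_bool (in_cells P (?S s + b a * 1)) + of_bool (in_cells P (?S s + b a * -1))) / 2) t"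
      by (subst signs_exp_insert_inner) (use insert.hyps in \<open>auto simp only: upd\<close>)
    also have "\<dots> \<le> signs_exp A (\<lambda>s. (1 / 2) * (of_bool (in_cells P1 (?S s)) + of_bool (in_cells P2 (?S s)))) t"
    proof (rule signs_exp_mono[OF insert.hyps(1)])
      fix s
      have "b a = \<beta> \<or> b a = - \<beta>" by (auto simp: \<beta>_def)
      then show "(of_bool (in_cells P (?S s + b a * 1)) + of_bool (in_cells P (?S s + b a * -1))) / 2 \<le>
          (1 / 2 :: real) * (of_bool (in_cells P1 (?S s)) + of_bool (in_cells P2 (?S s)))"
        using ptw[of "?S s"] by (elim disjE) (simp_all add: add.commute)
    qed
    also have "\<dots> = (1 / 2) * (signs_exp A (\<lambda>s. of_bool (in_cells P1 (?S s))) t +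
        signs_exp A (\<lambda>s. of_bool (in_cells P2 (?S s))) t)"
      using insert.hyps(1) by (simp only: signs_exp_cmult signs_exp_add)
    also have "\<dots> \<le> (1 / 2) * (walk_window (card A) (card P1) + walk_window (card A) (card P2))"
      using insert.prems(1) fin sep1 sep2 by (intro mult_left_mono add_mono insert.IH) auto
    also have "\<dots> = walk_window (card (insert a A)) (card P)"
      using insert.hyps card by (simp add: walk_window_Suc)
    finally show ?thesis .
  qed
qed

lemma in_cells_single: "in_cells {p} x \<longleftrightarrow> p \<le> x \<and> x < p + 2"
  by (simp add: in_cells_def)

lemma of_bool_interval_le_cells:
  assumes "0 < w"
  shows "(of_bool (p \<le> x \<and> x < p + w * real N) :: real) \<le>
     (\<Sum>i<N. of_bool (p + w * real i \<le> x \<and> x < p + w * real i + w))"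
proof (cases "p \<le> x \<and> x < p + w * real N")
  case True
  define i where "i = nat \<lfloor>(x - p) / w\<rfloor>"
  have "0 \<le> (x - p) / w" using True assms by simp
  then have "real i \<le> (x - p) / w" "(x - p) / w < real i + 1"
    unfolding i_def by linarith+
  moreover have "(x - p) / w < real N" using True assms by (simp add: field_simps)
  ultimately have "real i < real N" by linarith
  then have "i < N" by simp
  with \<open>real i \<le> (x - p) / w\<close> \<open>(x - p) / w < real i + 1\<close>
  have i: "i < N" "p + w * real i \<le> x" "x < p + w * real i + w"
    using assms by (auto simp: field_simps)
  have "(1::real) \<le> (\<Sum>i\<in>{i}. of_bool (p + w * real i \<le> x \<and> x < p + w * real i + w))"
    using i by simp
  also have "\<dots> \<le> (\<Sum>i<N. of_bool (p + w * real i \<le> x \<and> x < p + w * real i + w))"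
    using i(1) by (intro sum_mono2) auto
  finally show ?thesis using True by simp
next
  case False
  then show ?thesis
    by (simp only: of_bool_def if_not_P[OF False] if_False) (rule sum_nonneg, simp)
qed

lemma signs_exp_interval_le:
  assumes "finite A" "0 < w"
    and "\<And>p. signs_exp A (\<lambda>s. of_bool (p \<le> f s \<and> f s < p + w)) t \<le> B"
  shows "signs_exp A (\<lambda>s. of_bool (p \<le> f s \<and> f s < p + w * real N)) t \<le> real N * B"
proof -
  have "signs_exp A (\<lambda>s. of_bool (p \<le> f s \<and> f s < p + w * real N)) t \<le>
     signs_exp A (\<lambda>s. \<Sum>i<N. of_bool (p + w * real i \<le> f s \<and> f s < p + w * real i + w)) t"
    using assms by (intro signs_exp_mono of_bool_interval_le_cells)
  also have "\<dots> = (\<Sum>i<N. signs_exp A (\<lambda>s. of_bool (p + w * real i \<le> f s \<and> f s < p + w * real i + w)) t)"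
    using assms(1) by (rule signs_exp_sum)
  also have "\<dots> \<le> (\<Sum>i<N. B)" by (intro sum_mono assms)
  finally show ?thesis by simp
qed

text \<open>One cell of length 2 has at most the mass of the central binomial coefficient;
  \<open>N\<close> cells cover the interval.\<close>

lemma Littlewood_Offord:
  fixes b :: "'i \<Rightarrow> real"
  assumes "finite A" "\<And>i. i \<in> A \<Longrightarrow> 1 \<le> \<bar>b i\<bar>"
  shows "signs_exp A (\<lambda>s. of_bool (p \<le> (\<Sum>i\<in>A. b i * s i) \<and> (\<Sum>i\<in>A. b i * s i) < p + 2 * real N)) t
     \<le> real N / sqrt (real (card A + 1))"
proof -
  have "signs_exp A (\<lambda>s. of_bool (p \<le> (\<Sum>i\<in>A. b i * s i) \<and> (\<Sum>i\<in>A. b i * s i) < p + 2)) t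
     \<le> 1 / sqrt (real (card A + 1))" for p
  proof -
    have "signs_exp A (\<lambda>s. of_bool (p \<le> (\<Sum>i\<in>A. b i * s i) \<and> (\<Sum>i\<in>A. b i * s i) < p + 2)) t
      \<le> walk_window (card A) (card {p})"
      unfolding in_cells_single[symmetric] using assms by (intro Littlewood_Offord_cells) auto
    also have "\<dots> \<le> 1 / sqrt (real (card A + 1))" using walk_window_1_le by simp
    finally show ?thesis .
  qed
  then have "signs_exp A (\<lambda>s. of_bool (p \<le> (\<Sum>i\<in>A. b i * s i) \<and> (\<Sum>i\<in>A. b i * s i) < p + 2 * real N)) t
     \<le> real N * (1 / sqrt (real (card A + 1)))"
    using assms(1) by (intro signs_exp_interval_le) auto
  then show ?thesis by simp
qed

section \<open>Small balls, for failure probabilities above a constant\<close>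

text \<open>
  The products of adjacent signs are again independent signs.
\<close>
lemma signs_exp_adjacent_products:
  "signs_exp {1 - int m..1} (\<lambda>s. \<phi> (\<Sum>i<m. s (- int i) * s (1 - int i))) t =
   signs_exp {..<m} (\<lambda>s. \<phi> (\<Sum>i<m. s i)) t'"
proof (induction m arbitrary: \<phi>)
  case 0
  show ?case by (simp add: signs_exp_insert)
next
  case (Suc m)
  let ?P = "\<lambda>s. \<Sum>i<m. s (- int i) * s (1 - int i) :: real"
  have ins: "{1 - int (Suc m)..1} = insert (- int m) {1 - int m..1}" by auto
  have upd: "(\<Sum>i<Suc m. (s(- int m := y)) (- int i) * (s(- int m := y)) (1 - int i)) =
     ?P s + y * s (1 - int m)" for s y
  proof -
    have "(\<Sum>i<m. (s(- int m := y)) (- int i) * (s(- int m := y)) (1 - int i)) = ?P s"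
      by (intro sum.cong) auto
    then show ?thesis by simp
  qed
  have upd': "(\<Sum>i<Suc m. (s(m := y)) i) = (\<Sum>i<m. s i) + y" for s :: "nat \<Rightarrow> real" and y
  proof -
    have "(\<Sum>i<m. (s(m := y)) i) = (\<Sum>i<m. s i)" by (intro sum.cong) auto
    then show ?thesis by simp
  qed
  have "signs_exp {1 - int (Suc m)..1} (\<lambda>s. \<phi> (\<Sum>i<Suc m. s (- int i) * s (1 - int i))) t =
     signs_exp {1 - int m..1} (\<lambda>s. (\<phi> (?P s + 1 * s (1 - int m)) + \<phi> (?P s + -1 * s (1 - int m))) / 2) t"
    unfolding ins by (subst signs_exp_insert_inner) (auto simp only: upd, auto)
  \<comment> \<open>The average over the new sign is symmetric, so its multiplication by the fixed
    sign \<open>s (1 - int m)\<close> changes nothing.\<close>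
  also have "\<dots> = signs_exp {1 - int m..1} (\<lambda>s. (\<phi> (?P s + 1) + \<phi> (?P s + -1)) / 2) t"
  proof (rule signs_exp_cong)
    fix s assume "\<forall>a\<in>{1 - int m..1}. s a = 1 \<or> s a = (-1::real)"
    then have "s (1 - int m) = 1 \<or> s (1 - int m) = -1" by simp
    then show "(\<phi> (?P s + 1 * s (1 - int m)) + \<phi> (?P s + -1 * s (1 - int m))) / 2 =
      (\<phi> (?P s + 1) + \<phi> (?P s + -1)) / 2" by auto
  qed simp
  also have "\<dots> = signs_exp {..<m} (\<lambda>s. (\<phi> ((\<Sum>i<m. s i) + 1) + \<phi> ((\<Sum>i<m. s i) + -1)) / 2) t'"
    by (rule Suc.IH[of "\<lambda>z. (\<phi> (z + 1) + \<phi> (z + -1)) / 2"])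
  also have "\<dots> = signs_exp {..<Suc m} (\<lambda>s. \<phi> (\<Sum>i<Suc m. s i)) t'"
    using signs_exp_insert_inner[of "{..<m}" m "\<lambda>s. \<phi> (\<Sum>i<Suc m. s i)" t', unfolded upd']
    by (simp add: lessThan_Suc)
  finally show ?case .
qed

text \<open>For \<open>x\<close> uniform on two coordinates the square of a row is 1 plus or minus a
  product of adjacent signs. The distortion is then that of a simple random walk of \<open>m\<close>
  steps. The term 1 comes from rounding up the number of cells, so the bound is useful only for
  large \<open>m\<close>.\<close>

lemma two_point_small_ball:
  fixes m n :: nat and \<epsilon> :: real
  assumes n: "2 \<le> n" and m: "1 \<le> m" and \<epsilon>: "0 < \<epsilon>"
  obtains x where "x \<in> carrier_vec n" "euclidean_norm x = 1"
    "measure_pmf.prob (signs_pmf m n)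
       {s. \<bar>(euclidean_norm (hv_embedding m n s x))\<^sup>2 - 1\<bar> < \<epsilon>} \<le> (real m * \<epsilon> + 1) / sqrt (real m)"
proof
  define x where "x = vec n (\<lambda>j. if j < 2 then 1 / sqrt 2 else (0::real))"
  let ?X = "\<lambda>s. (euclidean_norm (hv_embedding m n s x))\<^sup>2 - 1"
  let ?S = "\<lambda>t. \<Sum>i<m. t (- int i) * t (1 - int i) :: real"
  show xc: "x \<in> carrier_vec n" by (simp add: x_def)
  have two: "(\<Sum>j<n. f j * x $ j) = (f 0 + f 1) / sqrt 2" for f :: "nat \<Rightarrow> real"
  proof -
    have "(\<Sum>j<n. f j * x $ j) = (\<Sum>j<2. f j / sqrt 2)"
      using n by (intro sum.mono_neutral_cong_right) (auto simp: x_def)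
    then show ?thesis by (simp add: numeral_2_eq_2 add_divide_distrib)
  qed
  have "(\<Sum>j<n. (x $ j)\<^sup>2) = 1"
    unfolding power2_eq_square by (subst two) (use n in \<open>simp add: x_def flip: power2_eq_square\<close>)
  then show "euclidean_norm x = 1"
    by (simp add: euclidean_norm_def L2_set_def x_def)
  show "measure_pmf.prob (signs_pmf m n) {s. \<bar>?X s\<bar> < \<epsilon>} \<le> (real m * \<epsilon> + 1) / sqrt (real m)"
  proof (rule signs_prob_le)
    fix d :: "nat \<Rightarrow> real" assume d: "\<forall>j<n. d j = 1 \<or> d j = -1"
    define N where "N = nat \<lceil>real m * \<epsilon>\<rceil>"
    have N: "real m * \<epsilon> \<le> real N" "real N \<le> real m * \<epsilon> + 1"
      using \<epsilon> by (auto simp: N_def real_nat_ceiling_ge)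
    have d01: "(d 0 * d 1) = 1 \<or> d 0 * d 1 = -1" "(d 0)\<^sup>2 = 1" "(d 1)\<^sup>2 = 1"
    proof -
      have "d 0 = 1 \<or> d 0 = -1" "d 1 = 1 \<or> d 1 = -1" using d n by auto
      then show "(d 0 * d 1) = 1 \<or> d 0 * d 1 = -1" "(d 0)\<^sup>2 = 1" "(d 1)\<^sup>2 = 1" by auto
    qed
    have sub: "{1 - int m..1} \<subseteq> {- (int m - 1)..int n - 1}" using n by auto
    have "signs_exp {1 - int m..1} (\<lambda>t. of_bool (\<bar>?X (t, d)\<bar> < \<epsilon>)) t \<le> (real m * \<epsilon> + 1) / sqrt (real m)" for t
    proof -
      have "signs_exp {1 - int m..1} (\<lambda>t. of_bool (\<bar>?X (t, d)\<bar> < \<epsilon>)) t \<le>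
         signs_exp {1 - int m..1} (\<lambda>t. of_bool (- (real m * \<epsilon>) \<le> ?S t \<and> ?S t < - (real m * \<epsilon>) + 2 * real N)) t"
      proof (rule signs_exp_mono)
        fix s assume s: "\<forall>a\<in>{1 - int m..1}. s a = 1 \<or> s a = (-1::real)"
        have "(\<Sum>j<n. s (int j - int i) * d j * x $ j)\<^sup>2 = 1 + (d 0 * d 1) * (s (- int i) * s (1 - int i))"
          if "i < m" for i
        proof -
          have "s (- int i) = 1 \<or> s (- int i) = -1" "s (1 - int i) = 1 \<or> s (1 - int i) = -1"
            using s that by auto
          then have "(s (- int i))\<^sup>2 = 1" "(s (1 - int i))\<^sup>2 = 1" by auto
          then show ?thesis using d01
            by (subst two) (simp add: power_divide power2_sum power_mult_distrib mult_ac)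
        qed
        then have "(euclidean_norm (hv_embedding m n (s, d) x))\<^sup>2 = (real m + (d 0 * d 1) * ?S s) / real m"
          by (subst hv_embedding_norm[OF xc]) (simp add: sum.distrib sum_distrib_left)
        then have "?X (s, d) = (d 0 * d 1) * ?S s / real m"
          using m by (simp add: field_simps)
        then have "\<bar>?X (s, d)\<bar> = \<bar>d 0 * d 1\<bar> * \<bar>?S s\<bar> / real m"
          by (simp only: abs_mult abs_divide abs_of_nat)
        moreover have "\<bar>d 0 * d 1\<bar> = 1" using d01(1) by auto
        ultimately have eq: "\<bar>?X (s, d)\<bar> = \<bar>?S s\<bar> / real m" by simp
        have "\<bar>?X (s, d)\<bar> < \<epsilon> \<longleftrightarrow> \<bar>?S s\<bar> < real m * \<epsilon>"
          unfolding eq using m by (simp add: pos_divide_less_eq mult.commute)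
        then show "(of_bool (\<bar>?X (s, d)\<bar> < \<epsilon>) :: real) \<le>
            of_bool (- (real m * \<epsilon>) \<le> ?S s \<and> ?S s < - (real m * \<epsilon>) + 2 * real N)"
          using N(1) by (auto simp: of_bool_def)
      qed simp
      also have "\<dots> = signs_exp {..<m} (\<lambda>s. of_bool (- (real m * \<epsilon>) \<le> (\<Sum>i<m. 1 * s i) \<and>
          (\<Sum>i<m. 1 * s i) < - (real m * \<epsilon>) + 2 * real N)) (\<lambda>_. 0)"
        unfolding mult_1_left
        by (rule signs_exp_adjacent_products[where \<phi> = "\<lambda>z. of_bool (- (real m * \<epsilon>) \<le> z \<and> z < - (real m * \<epsilon>) + 2 * real N)"])
      also have "\<dots> \<le> real N / sqrt (real (card {..<m} + 1))"
        by (rule Littlewood_Offord) auto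
      also have "\<dots> \<le> (real m * \<epsilon> + 1) / sqrt (real m)"
        using N m \<epsilon> by (intro frac_le) auto
      finally show ?thesis .
    qed
    then show "signs_exp {- (int m - 1)..int n - 1} (\<lambda>t. of_bool (\<bar>?X (t, d)\<bar> < \<epsilon>)) (\<lambda>_. 0)
       \<le> (real m * \<epsilon> + 1) / sqrt (real m)"
      by (rule signs_exp_superset_le[OF finite_atLeastAtMost_int sub])
  qed
qed

section \<open>Smooth distributions from binary digits\<close>

text \<open>Different sign patterns give sums at distance at least 2, so a half-open cell of length
  2 contains at most one of the \<open>2 ^ q\<close> equally likely values.\<close>

lemma binary_digits_cell:
  fixes e :: "nat \<Rightarrow> 'i" and \<alpha> :: "nat \<Rightarrow> real"
  assumes "inj_on e {..<q}" "\<And>l. l < q \<Longrightarrow> \<bar>\<alpha> l\<bar> = 2 ^ l"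
  shows "signs_exp (e ` {..<q}) (\<lambda>s. of_bool (z \<le> (\<Sum>l<q. \<alpha> l * s (e l)) \<and> (\<Sum>l<q. \<alpha> l * s (e l)) < z + 2)) t
     \<le> (1 / 2) ^ q"
  using assms
proof (induction q arbitrary: z t)
  case 0
  then show ?case by simp
next
  case (Suc q)
  let ?A = "e ` {..<q}" and ?S = "\<lambda>s. \<Sum>l<q. \<alpha> l * s (e l)"
  let ?F = "\<lambda>z s. of_bool (z \<le> ?S s \<and> ?S s < z + 2) :: real"
  have inj: "inj_on e {..<q}" using Suc.prems(1) by (rule inj_on_subset) auto
  have new: "e q \<notin> ?A" by (auto dest: inj_onD[OF Suc.prems(1)])
  have ins: "e ` {..<Suc q} = insert (e q) ?A" by (auto simp: lessThan_Suc)
  have step: "signs_exp ?A (\<lambda>s. of_bool (z \<le> (\<Sum>l<Suc q. \<alpha> l * s (e l)) \<and> (\<Sum>l<Suc q. \<alpha> l * s (e l)) < z + 2)) (t(e q := y))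
     = signs_exp ?A (?F (z - \<alpha> q * y)) (t(e q := y))" for y
    using new by (intro signs_exp_cong) (auto simp: algebra_simps)
  have IH: "signs_exp ?A (?F z') t' \<le> (1 / 2) ^ q" for z' t'
    using Suc.prems(2) by (intro Suc.IH inj) auto
  have bound: "\<bar>?S s\<bar> \<le> 2 ^ q - 1" if "\<forall>a\<in>?A. s a = 1 \<or> s a = -1" for s :: "'i \<Rightarrow> real"
  proof -
    have one: "\<bar>s (e l)\<bar> = 1" if "l < q" for l
    proof -
      have "s (e l) = 1 \<or> s (e l) = -1" using \<open>\<forall>a\<in>?A. s a = 1 \<or> s a = -1\<close> that by simp
      then show ?thesis by auto
    qed
    have "\<bar>?S s\<bar> \<le> (\<Sum>l<q. \<bar>\<alpha> l * s (e l)\<bar>)" by (rule sum_abs)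
    also have "\<dots> = (\<Sum>l<q. 2 ^ l)"
      using one Suc.prems(2) by (intro sum.cong) (auto simp: abs_mult)
    also have "\<dots> = 2 ^ q - (1::real)" using geometric_sum[of "2::real" q] by simp
    finally show ?thesis .
  qed
  have zero: "signs_exp ?A (?F z') t' = 0" if "2 ^ q - 1 < z' \<or> z' + 2 \<le> - (2 ^ q - 1)" for z' t'
  proof -
    have "signs_exp ?A (?F z') t' = signs_exp ?A (\<lambda>_. 0) t'"
    proof (rule signs_exp_cong)
      fix s :: "'i \<Rightarrow> real" assume "\<forall>a\<in>?A. s a = 1 \<or> s a = -1"
      then have "\<bar>?S s\<bar> \<le> 2 ^ q - 1" by (rule bound)
      then have "\<not> (z' \<le> ?S s \<and> ?S s < z' + 2)" using that by linarith
      then show "?F z' s = 0" by simp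
    qed simp
    then show ?thesis by simp
  qed
  \<comment> \<open>The top digit shifts the cell by \<open>2 ^ q\<close> to either side. The lower
    digits stay in an interval of length \<open>2 ^ (q + 1) - 2\<close>, which cannot meet both
    shifted cells.\<close>
  have "signs_exp ?A (?F (z - \<alpha> q)) (t(e q := 1)) + signs_exp ?A (?F (z + \<alpha> q)) (t(e q := -1)) \<le> (1 / 2) ^ q"
  proof -
    have "\<alpha> q = 2 ^ q \<or> \<alpha> q = - (2 ^ q)" using Suc.prems(2)[of q] by auto
    then have "(2 ^ q - 1 < z - \<alpha> q \<or> z - \<alpha> q + 2 \<le> - (2 ^ q - 1)) \<or>
        (2 ^ q - 1 < z + \<alpha> q \<or> z + \<alpha> q + 2 \<le> - (2 ^ q - 1))"
      by (elim disjE) linarith+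
    then show ?thesis
    proof
      assume "2 ^ q - 1 < z - \<alpha> q \<or> z - \<alpha> q + 2 \<le> - (2 ^ q - 1)"
      from zero[OF this, of "t(e q := 1)"] IH[of "z + \<alpha> q" "t(e q := -1)"] show ?thesis by linarith
    next
      assume "2 ^ q - 1 < z + \<alpha> q \<or> z + \<alpha> q + 2 \<le> - (2 ^ q - 1)"
      from zero[OF this, of "t(e q := -1)"] IH[of "z - \<alpha> q" "t(e q := 1)"] show ?thesis by linarith
    qed
  qed
  then show ?case
    unfolding ins using new by (subst signs_exp_insert) (simp_all only: step, simp_all)
qed

text \<open>
  The terms \<open>l < q\<close> sum to a uniform point of a lattice in \<open>[-1/2, 1/2]\<close>. The term \<open>q\<close> keeps the
  whole sum away from 0, where squaring would concentrate the mass.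
\<close>
lemma smooth_square_window:
  fixes e :: "nat \<Rightarrow> 'i" and \<alpha> :: "nat \<Rightarrow> real"
  assumes e: "inj_on e {..q}"
    and \<alpha>: "\<And>l. l < q \<Longrightarrow> \<bar>\<alpha> l\<bar> = 2 ^ l / 2 ^ (q + 1)" "19 / 20 \<le> \<bar>\<alpha> q\<bar>" "\<bar>\<alpha> q\<bar> \<le> 1"
    and u: "(1 / 2) ^ q \<le> u" "u \<le> 1"
  shows "signs_exp (e ` {..q}) (\<lambda>s. of_bool (\<bar>(\<Sum>l\<le>q. \<alpha> l * s (e l))\<^sup>2 - z\<bar> < u)) t
     \<le> 6 * u * of_bool (-1 \<le> z \<and> z < 13 / 4)"
proof -
  let ?A = "e ` {..<q}" and ?S = "\<lambda>s. \<Sum>l<q. \<alpha> l * s (e l)"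
  have "0 < (1 / 2 :: real) ^ q" by simp
  then have u0: "0 < u" using u(1) by linarith
  have inj: "inj_on e {..<q}" using e by (rule inj_on_subset) auto
  have new: "e q \<notin> ?A" by (auto dest: inj_onD[OF e])
  have ins: "e ` {..q} = insert (e q) ?A" by (simp flip: lessThan_Suc_atMost add: lessThan_Suc)
  have bound: "\<bar>?S s\<bar> \<le> 1 / 2" if "\<forall>a\<in>?A. s a = 1 \<or> s a = -1" for s :: "'i \<Rightarrow> real"
  proof -
    have one: "\<bar>s (e l)\<bar> = 1" if "l < q" for l
    proof -
      have "s (e l) = 1 \<or> s (e l) = -1" using \<open>\<forall>a\<in>?A. s a = 1 \<or> s a = -1\<close> that by simp
      then show ?thesis by auto
    qed
    have "\<bar>?S s\<bar> \<le> (\<Sum>l<q. \<bar>\<alpha> l * s (e l)\<bar>)" by (rule sum_abs)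
    also have "\<dots> = (\<Sum>l<q. 2 ^ l / 2 ^ (q + 1))"
      using one \<alpha>(1) by (intro sum.cong) (auto simp: abs_mult)
    also have "\<dots> = (2 ^ q - 1) / (2::real) ^ (q + 1)"
      using geometric_sum[of "2::real" q] by (simp flip: sum_divide_distrib)
    also have "\<dots> \<le> 1 / 2" by (simp add: field_simps)
    finally show ?thesis .
  qed
  have window: "signs_exp ?A (\<lambda>s. of_bool (p \<le> ?S s \<and> ?S s < p + 5 * u)) t \<le> 6 * u" for p t
  proof -
    define g where "g = 1 / (2::real) ^ (q + 1)"
    have g: "0 < g" by (simp add: g_def)
    \<comment> \<open>The lattice has spacing \<open>2 * g = (1 / 2) ^ q\<close>, and each cell has
      mass at most \<open>(1 / 2) ^ q\<close>. Rounding up costs one more cell, of mass at most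
      \<open>u\<close>.\<close>
    define N where "N = nat \<lceil>5 * u / (2 * g)\<rceil>"
    have N: "5 * u / (2 * g) \<le> real N" "real N \<le> 5 * u / (2 * g) + 1"
      using u0 g by (auto simp: N_def real_nat_ceiling_ge)
    have "p + 5 * u \<le> p + (2 * g) * real N" using N(1) g by (simp add: field_simps)
    then have "signs_exp ?A (\<lambda>s. of_bool (p \<le> ?S s \<and> ?S s < p + 5 * u)) t \<le>
        signs_exp ?A (\<lambda>s. of_bool (p \<le> ?S s \<and> ?S s < p + (2 * g) * real N)) t"
      by (intro signs_exp_mono) (auto simp: of_bool_def)
    also have "\<dots> \<le> real N * (1 / 2) ^ q"
    proof (rule signs_exp_interval_le)
      fix p
      have "\<bar>\<alpha> l / g\<bar> = 2 ^ l" if "l < q" for l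
        using \<alpha>(1)[OF that] by (simp add: g_def abs_mult)
      then have "signs_exp ?A (\<lambda>s. of_bool (p / g \<le> (\<Sum>l<q. (\<alpha> l / g) * s (e l)) \<and>
          (\<Sum>l<q. (\<alpha> l / g) * s (e l)) < p / g + 2)) t \<le> (1 / 2) ^ q"
        by (rule binary_digits_cell[OF inj])
      moreover have "(\<Sum>l<q. (\<alpha> l / g) * s (e l)) = ?S s / g" for s
        by (simp add: sum_divide_distrib)
      moreover have "p / g \<le> y / g \<and> y / g < p / g + 2 \<longleftrightarrow> p \<le> y \<and> y < p + 2 * g" for y
        using g by (simp add: field_simps)
      ultimately show "signs_exp ?A (\<lambda>s. of_bool (p \<le> ?S s \<and> ?S s < p + 2 * g)) t \<le> (1 / 2) ^ q"
        by (simp only:)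
    qed (use g in auto)
    also have "\<dots> \<le> (5 * u / (2 * g) + 1) * (1 / 2) ^ q"
      using N(2) by (intro mult_right_mono) auto
    also have "\<dots> = 5 * u + (1 / 2) ^ q"
      by (simp add: g_def field_simps power_divide)
    finally show ?thesis using u(1) by linarith
  qed
  show ?thesis
  proof (cases "-1 \<le> z \<and> z < 13 / 4")
    case True
    have half: "signs_exp ?A (\<lambda>s. of_bool (\<bar>(\<Sum>l\<le>q. \<alpha> l * s (e l))\<^sup>2 - z\<bar> < u)) (t(e q := y)) \<le> 6 * u"
      if y: "y = 1 \<or> y = -1" for y
    proof -
      define c where "c = \<alpha> q * y"
      have c: "19 / 20 \<le> \<bar>c\<bar>" using y \<alpha>(2) by (auto simp: c_def)
      let ?E = "\<lambda>\<rho>. \<bar>\<rho>\<bar> \<le> 1 / 2 \<and> \<bar>(\<rho> + c)\<^sup>2 - z\<bar> < u"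
      have eq: "(\<Sum>l\<le>q. \<alpha> l * s (e l)) = ?S s + c" if "\<forall>a. a \<notin> ?A \<longrightarrow> s a = (t(e q := y)) a" for s
        using that new by (simp add: c_def flip: lessThan_Suc_atMost)
      show ?thesis
      proof (cases "\<exists>\<rho>. ?E \<rho>")
        case False
        have "signs_exp ?A (\<lambda>s. of_bool (\<bar>(\<Sum>l\<le>q. \<alpha> l * s (e l))\<^sup>2 - z\<bar> < u)) (t(e q := y)) =
            signs_exp ?A (\<lambda>_. 0) (t(e q := y))"
          using False bound by (intro signs_exp_cong) (auto simp: eq)
        then show ?thesis using u0 by simp
      next
        case True
        then obtain \<rho>0 where r0: "?E \<rho>0" by blast
        \<comment> \<open>\<open>\<rho> + \<rho>0 + 2 * c\<close> has modulus at least 19/10 - 1 =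
          9/10, which bounds the contraction by squaring; 20/9 is below 5/2.\<close>
        have close: "\<rho>0 - 5 / 2 * u \<le> \<rho> \<and> \<rho> < \<rho>0 - 5 / 2 * u + 5 * u" if r: "?E \<rho>" for \<rho>
        proof -
          have "\<bar>(\<rho> + c)\<^sup>2 - (\<rho>0 + c)\<^sup>2\<bar> < 2 * u" using r r0 by linarith
          moreover have "(\<rho> + c)\<^sup>2 - (\<rho>0 + c)\<^sup>2 = (\<rho> - \<rho>0) * (\<rho> + \<rho>0 + 2 * c)"
            by (simp add: power2_eq_square algebra_simps)
          ultimately have "\<bar>\<rho> - \<rho>0\<bar> * \<bar>\<rho> + \<rho>0 + 2 * c\<bar> < 2 * u" by (simp add: abs_mult)
          moreover have "9 / 10 \<le> \<bar>\<rho> + \<rho>0 + 2 * c\<bar>" using r r0 c by linarith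
          then have "\<bar>\<rho> - \<rho>0\<bar> * (9 / 10) \<le> \<bar>\<rho> - \<rho>0\<bar> * \<bar>\<rho> + \<rho>0 + 2 * c\<bar>"
            by (intro mult_left_mono) auto
          ultimately have "\<bar>\<rho> - \<rho>0\<bar> * (9 / 10) < 2 * u" by (rule le_less_trans[rotated])
          then have "\<bar>\<rho> - \<rho>0\<bar> < 20 / 9 * u" by (simp add: field_simps)
          then have "\<rho> - \<rho>0 < 20 / 9 * u \<and> - (\<rho> - \<rho>0) < 20 / 9 * u"
            by (simp only: abs_less_iff)
          then show ?thesis using u0 by (intro conjI) (elim conjE; linarith)+
        qed
        have "signs_exp ?A (\<lambda>s. of_bool (\<bar>(\<Sum>l\<le>q. \<alpha> l * s (e l))\<^sup>2 - z\<bar> < u)) (t(e q := y)) \<le>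
            signs_exp ?A (\<lambda>s. of_bool (\<rho>0 - 5 / 2 * u \<le> ?S s \<and> ?S s < \<rho>0 - 5 / 2 * u + 5 * u)) (t(e q := y))"
        proof (rule signs_exp_mono)
          fix s :: "'i \<Rightarrow> real" assume s: "\<forall>a\<in>?A. s a = 1 \<or> s a = -1" "\<forall>a. a \<notin> ?A \<longrightarrow> s a = (t(e q := y)) a"
          show "of_bool (\<bar>(\<Sum>l\<le>q. \<alpha> l * s (e l))\<^sup>2 - z\<bar> < u) \<le>
              (of_bool (\<rho>0 - 5 / 2 * u \<le> ?S s \<and> ?S s < \<rho>0 - 5 / 2 * u + 5 * u) :: real)"
            using close[of "?S s"] bound[OF s(1)] eq[OF s(2)] by (auto simp: of_bool_def)
        qed simp
        also have "\<dots> \<le> 6 * u" by (rule window)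
        finally show ?thesis .
      qed
    qed
    have "signs_exp (e ` {..q}) (\<lambda>s. of_bool (\<bar>(\<Sum>l\<le>q. \<alpha> l * s (e l))\<^sup>2 - z\<bar> < u)) t \<le> 6 * u"
      unfolding ins using new half[of 1] half[of "-1"] by (subst signs_exp_insert) auto
    then show ?thesis using True by simp
  next
    case False
    \<comment> \<open>The sum is at most 3/2 in modulus, so its square is at most 9/4. As
      \<open>u \<le> 1\<close>, such a \<open>z\<close> is out of reach.\<close>
    have "signs_exp (e ` {..q}) (\<lambda>s. of_bool (\<bar>(\<Sum>l\<le>q. \<alpha> l * s (e l))\<^sup>2 - z\<bar> < u)) t =
        signs_exp (e ` {..q}) (\<lambda>_. 0) t"
    proof (rule signs_exp_cong)
      fix s :: "'i \<Rightarrow> real" assume s: "\<forall>a\<in>e ` {..q}. s a = 1 \<or> s a = -1"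
      have "\<bar>?S s\<bar> \<le> 1 / 2" using s by (intro bound) auto
      moreover have "s (e q) = 1 \<or> s (e q) = -1" using s by simp
      then have "\<bar>\<alpha> q * s (e q)\<bar> \<le> 1" using \<alpha>(3) by (auto simp: abs_mult)
      moreover have "(\<Sum>l\<le>q. \<alpha> l * s (e l)) = ?S s + \<alpha> q * s (e q)"
        by (simp flip: lessThan_Suc_atMost)
      ultimately have "\<bar>\<Sum>l\<le>q. \<alpha> l * s (e l)\<bar> \<le> 3 / 2"
        using abs_triangle_ineq[of "?S s" "\<alpha> q * s (e q)"] by simp
      then have "(\<Sum>l\<le>q. \<alpha> l * s (e l))\<^sup>2 \<le> (3 / 2)\<^sup>2" using power_mono[OF _ abs_ge_zero, of _ "3/2" 2] by fastforce
      moreover have "(3 / 2)\<^sup>2 = (9 / 4 :: real)" by (simp add: power2_eq_square)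
      moreover have "0 \<le> (\<Sum>l\<le>q. \<alpha> l * s (e l))\<^sup>2" by simp
      moreover have "z < -1 \<or> 13 / 4 \<le> z" using False by auto
      ultimately have "\<not> \<bar>(\<Sum>l\<le>q. \<alpha> l * s (e l))\<^sup>2 - z\<bar> < u"
        using u(2) by (elim disjE) linarith+
      then show "of_bool (\<bar>(\<Sum>l\<le>q. \<alpha> l * s (e l))\<^sup>2 - z\<bar> < u) = (0::real)" by simp
    qed simp
    then show ?thesis using False by auto
  qed
qed

text \<open>
  The support of \<open>x\<close> consists of multiples of \<open>m\<close>, so that the rows of the matrix act through
  disjoint sets of entries. Row 0 spreads its square over an interval of constant length, and the
  squares of the other rows are in such an interval with probability \<open>O(1 / sqrt m)\<close> by the
  Littlewood--Offord inequality for the entries of column \<open>k * m\<close>.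
\<close>
lemma separated_small_ball:
  fixes m n k :: nat and \<epsilon> :: real
  assumes m: "1 \<le> m" and n: "Suc k * m + 1 \<le> n"
    and \<epsilon>: "(1 / 2) ^ Suc k \<le> real m * \<epsilon>" "real m * \<epsilon> \<le> 1"
  obtains x where "x \<in> carrier_vec n" "euclidean_norm x = 1"
    "measure_pmf.prob (signs_pmf m n)
       {s. \<bar>(euclidean_norm (hv_embedding m n s x))\<^sup>2 - 1\<bar> < \<epsilon>} \<le> 42 * (real m * \<epsilon>) / sqrt (real m)"
proof
  define q where "q = Suc k"
  define u where "u = real m * \<epsilon>"
  define W where "W = (\<Sum>l<q. (2 ^ l / (2::real) ^ (q + 1))\<^sup>2)"
  \<comment> \<open>Binary digits, and a last weight that completes the norm to 1. It is at least
    19/20 because \<open>W \<le> 1 / 12\<close>.\<close>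
  define wt where "wt = (\<lambda>l. if l < q then 2 ^ l / (2::real) ^ (q + 1) else sqrt (1 - W))"
  define x where "x = vec n (\<lambda>j. if m dvd j \<and> j div m \<le> q then wt (j div m) else 0)"
  let ?X = "\<lambda>s. (euclidean_norm (hv_embedding m n s x))\<^sup>2 - 1"
  have u: "(1 / 2) ^ q \<le> u" "u \<le> 1" using \<epsilon> by (auto simp: u_def q_def)
  have W: "0 \<le> W" "W \<le> 1 / 12"
  proof -
    show "0 \<le> W" by (auto simp: W_def intro!: sum_nonneg)
    have "(2 ^ j)\<^sup>2 = (4::real) ^ j" for j :: nat
      by (simp add: power2_eq_square flip: power_mult_distrib)
    then have "W = (\<Sum>l<q. 4 ^ l) / 4 ^ (q + 1)"
      unfolding W_def by (simp only: power_divide sum_divide_distrib)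
    also have "(\<Sum>l<q. 4 ^ l) = ((4::real) ^ q - 1) / 3" using geometric_sum[of "4::real" q] by simp
    finally have "W = (1 - 1 / 4 ^ q) / 12" by (simp add: field_simps)
    moreover have "0 \<le> 1 / (4::real) ^ q" by simp
    ultimately show "W \<le> 1 / 12" by simp
  qed
  have wt0: "0 \<le> wt l" for l using W by (simp add: wt_def)
  have wtq: "19 / 20 \<le> wt q" "wt q \<le> 1"
  proof -
    have "(19 / 20)\<^sup>2 \<le> 1 - W" using W by (simp add: power2_eq_square)
    then have "19 / 20 \<le> sqrt (1 - W)" by (rule real_le_rsqrt)
    then show "19 / 20 \<le> wt q" by (simp add: wt_def)
    show "wt q \<le> 1" using W by (simp add: wt_def)
  qed
  show xc: "x \<in> carrier_vec n" by (simp add: x_def)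
  have comb: "(\<Sum>j<n. f j * x $ j) = (\<Sum>l\<le>q. f (l * m) * wt l)" for f :: "nat \<Rightarrow> real"
  proof -
    have lm: "l * m < n" if "l \<le> q" for l
      using mult_right_mono[OF that, of m] n by (simp add: q_def)
    have "(\<Sum>j<n. f j * x $ j) = (\<Sum>j\<in>(\<lambda>l. l * m) ` {..q}. f j * x $ j)"
    proof (rule sum.mono_neutral_right)
      show "\<forall>j\<in>{..<n} - (\<lambda>l. l * m) ` {..q}. f j * x $ j = 0"
      proof
        fix j assume j: "j \<in> {..<n} - (\<lambda>l. l * m) ` {..q}"
        have "\<not> (m dvd j \<and> j div m \<le> q)"
        proof
          assume "m dvd j \<and> j div m \<le> q"
          then have "j = (j div m) * m" "j div m \<in> {..q}" by auto
          then show False using j by blast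
        qed
        then show "f j * x $ j = 0" using j by (auto simp: x_def)
      qed
    qed (use lm in auto)
    also have "\<dots> = (\<Sum>l\<le>q. f (l * m) * x $ (l * m))"
      using m by (subst sum.reindex) (auto simp: inj_on_def)
    also have "\<dots> = (\<Sum>l\<le>q. f (l * m) * wt l)"
      using m lm by (intro sum.cong) (auto simp: x_def)
    finally show ?thesis .
  qed
  have "(\<Sum>j<n. (x $ j)\<^sup>2) = (\<Sum>l\<le>q. x $ (l * m) * wt l)"
    unfolding power2_eq_square by (rule comb)
  also have "\<dots> = (\<Sum>l\<le>q. (wt l)\<^sup>2)"
  proof (intro sum.cong refl)
    fix l assume "l \<in> {..q}"
    then have "l * m < n" using mult_right_mono[of l q m] n by (simp add: q_def)
    then show "x $ (l * m) * wt l = (wt l)\<^sup>2"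
      using \<open>l \<in> {..q}\<close> m by (simp add: x_def power2_eq_square)
  qed
  also have "\<dots> = 1" using W by (simp add: wt_def W_def flip: lessThan_Suc_atMost)
  finally show "euclidean_norm x = 1"
    by (simp add: euclidean_norm_def L2_set_def x_def)
  show "measure_pmf.prob (signs_pmf m n) {s. \<bar>?X s\<bar> < \<epsilon>} \<le> 42 * (real m * \<epsilon>) / sqrt (real m)"
  proof (rule signs_prob_le)
    fix d :: "nat \<Rightarrow> real" assume d: "\<forall>j<n. d j = 1 \<or> d j = -1"
    \<comment> \<open>The index of the Toeplitz entry that row \<open>i\<close> reads in column
      \<open>l * m\<close>; for \<open>i < m\<close> it determines both \<open>i\<close> and
      \<open>l\<close>.\<close>
    define e where "e = (\<lambda>i l. int (l * m) - int i)"
    define \<alpha> where "\<alpha> = (\<lambda>l. d (l * m) * wt l)"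
    define r where "r = (\<lambda>i s. \<Sum>l\<le>q. \<alpha> l * s (e i l))"
    define B where "B = (\<lambda>s. \<Sum>i\<in>{1..<m}. (r i s)\<^sup>2)"
    define I where "I = {- (int m - 1)..int n - 1}"
    define R0 where "R0 = e 0 ` {..q}"
    \<comment> \<open>Column \<open>k * m\<close> carries the largest digit, of weight 1/4. Row 0 is
      excluded.\<close>
    define C where "C = (\<lambda>i. e i k) ` {1..<m}"
    let ?F = "\<lambda>s. of_bool (\<bar>?X (s, d)\<bar> < \<epsilon>) :: real"
    have \<alpha>: "\<bar>\<alpha> l\<bar> = wt l" if "l \<le> q" for l
    proof -
      have "l * m < n" using mult_right_mono[OF that, of m] n by (simp add: q_def)
      then show ?thesis using d wt0[of l] by (auto simp: \<alpha>_def abs_mult)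
    qed
    have e_inj: "i = i' \<and> l = l'" if "e i l = e i' l'" "i < m" "i' < m" for i i' l l'
    proof -
      have eq: "l * m + i' = l' * m + i"
        using that(1) unfolding e_def by (simp flip: of_nat_add of_nat_mult add: algebra_simps)
      have "i' = (l * m + i') mod m" using that(3) by simp
      also have "\<dots> = (l' * m + i) mod m" by (simp only: eq)
      also have "\<dots> = i" using that(2) by simp
      finally show ?thesis using eq m by simp
    qed
    have e_I: "e i l \<in> I" if "i < m" "l \<le> q" for i l
    proof -
      have "l * m < n" using mult_right_mono[OF that(2), of m] n by (simp add: q_def)
      then have "int (l * m) \<le> int n - 1" "0 \<le> int (l * m)" by linarith+
      then show ?thesis using that(1) unfolding e_def I_def atLeastAtMost_iff by linarith
    qed
    have Xr: "\<bar>?X (s, d)\<bar> < \<epsilon> \<longleftrightarrow> \<bar>(r 0 s)\<^sup>2 - (real m - B s)\<bar> < u" for s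
    proof -
      have "(\<Sum>i<m. (r i s)\<^sup>2) = (\<Sum>i\<in>insert 0 {1..<m}. (r i s)\<^sup>2)"
        using m by (intro sum.cong) auto
      then have sum_r: "(\<Sum>i<m. (r i s)\<^sup>2) = (r 0 s)\<^sup>2 + B s" by (simp add: B_def)
      have "(\<Sum>j<n. s (int j - int i) * d j * x $ j) = r i s" for i
        by (subst comb) (simp add: r_def \<alpha>_def e_def mult_ac)
      then have "?X (s, d) = ((r 0 s)\<^sup>2 - (real m - B s)) / real m"
        using m by (subst hv_embedding_norm[OF xc]) (simp add: sum_r field_simps)
      then have eq: "\<bar>?X (s, d)\<bar> = \<bar>(r 0 s)\<^sup>2 - (real m - B s)\<bar> / real m"
        by (simp only: abs_divide abs_of_nat)
      show ?thesis unfolding eq u_def using m by (simp add: pos_divide_less_eq mult.commute)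
    qed
    have fin: "finite R0" "finite C" by (auto simp: R0_def C_def)
    have disj: "C \<inter> R0 = {}"
      using e_inj[of _ k 0] m by (fastforce simp: C_def R0_def)
    have sub: "C \<union> R0 \<subseteq> I"
      using m by (auto simp: C_def R0_def q_def intro!: e_I)
    have row0: "signs_exp R0 ?F t \<le> 6 * u * of_bool (-1 \<le> real m - B t \<and> real m - B t < 13 / 4)" for t
    proof -
      have "signs_exp R0 ?F t = signs_exp R0 (\<lambda>s. of_bool (\<bar>(r 0 s)\<^sup>2 - (real m - B t)\<bar> < u)) t"
      proof (rule signs_exp_cong[OF fin(1)])
        fix s assume s: "\<forall>a. a \<notin> R0 \<longrightarrow> s a = t a"
        have "e i l \<notin> R0" if "i \<in> {1..<m}" for i l
          using e_inj[of i l 0] that by (fastforce simp: R0_def)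
        then have "B s = B t" using s by (auto simp: B_def r_def intro!: sum.cong)
        then show "?F s = of_bool (\<bar>(r 0 s)\<^sup>2 - (real m - B t)\<bar> < u)" by (simp add: Xr)
      qed
      also have "\<dots> \<le> 6 * u * of_bool (-1 \<le> real m - B t \<and> real m - B t < 13 / 4)"
        unfolding R0_def r_def
      proof (rule smooth_square_window)
        show "inj_on (e 0) {..q}" using e_inj m by (auto simp: inj_on_def)
        show "\<bar>\<alpha> l\<bar> = 2 ^ l / 2 ^ (q + 1)" if "l < q" for l
          using \<alpha>[of l] that by (simp add: wt_def)
      qed (use wtq u \<alpha>[of q] in auto)
      finally show ?thesis .
    qed
    \<comment> \<open>Given the other entries, the square of row \<open>i\<close> is affine in its
      sign in column \<open>k * m\<close>, with coefficient \<open>2 * \<alpha> k * v i\<close>. The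
      factor 3 below raises the modulus to at least 6 * 1/4 * 7/10 > 1, as
      \<open>Littlewood_Offord\<close> requires.\<close>
    have rows: "signs_exp C (\<lambda>s. of_bool (-1 \<le> real m - B s \<and> real m - B s < 13 / 4)) t \<le> 7 / sqrt (real m)"
      if t: "\<forall>a\<in>I - (C \<union> R0). t a = 1 \<or> t a = -1" for t
    proof -
      define v where "v = (\<lambda>i. (\<Sum>l<k. \<alpha> l * t (e i l)) + \<alpha> q * t (e i q))"
      define b where "b = (\<lambda>c. 6 * \<alpha> k * v (nat (int (k * m) - c)))"
      define K where "K = (\<Sum>i\<in>{1..<m}. 3 * ((\<alpha> k)\<^sup>2 + (v i)\<^sup>2))"
      have notC: "e i l \<notin> C \<union> R0" if "i \<in> {1..<m}" "l \<noteq> k" for i l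
        using e_inj[of i l _ k] e_inj[of i l 0] that by (fastforce simp: R0_def C_def)
      have ak: "\<bar>\<alpha> k\<bar> = 1 / 4" using \<alpha>[of k] by (simp add: wt_def q_def)
      have v: "7 / 10 \<le> \<bar>v i\<bar>" if i: "i \<in> {1..<m}" for i
      proof -
        have tt: "\<bar>t (e i l)\<bar> = 1" if "l \<le> q" "l \<noteq> k" for l
        proof -
          have "e i l \<in> I - (C \<union> R0)" using e_I[of i l] notC[of i l] i that by auto
          then have "t (e i l) = 1 \<or> t (e i l) = -1" using t by blast
          then show ?thesis by auto
        qed
        have "\<bar>\<Sum>l<k. \<alpha> l * t (e i l)\<bar> \<le> (\<Sum>l<k. \<bar>\<alpha> l * t (e i l)\<bar>)" by (rule sum_abs)
        also have "\<dots> = (\<Sum>l<k. 2 ^ l / 2 ^ (q + 1))"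
          using \<alpha> tt by (intro sum.cong) (auto simp: abs_mult wt_def q_def)
        also have "\<dots> = (2 ^ k - 1) / (2::real) ^ (q + 1)"
          using geometric_sum[of "2::real" k] by (simp flip: sum_divide_distrib)
        also have "\<dots> \<le> 1 / 4" by (simp add: q_def field_simps)
        finally have "\<bar>\<Sum>l<k. \<alpha> l * t (e i l)\<bar> \<le> 1 / 4" .
        moreover have "19 / 20 \<le> \<bar>\<alpha> q * t (e i q)\<bar>"
          using wtq \<alpha>[of q] tt[of q] by (simp add: abs_mult q_def)
        ultimately show ?thesis unfolding v_def by linarith
      qed
      have b: "1 \<le> \<bar>b c\<bar>" if c: "c \<in> C" for c
      proof -
        obtain i where i: "i \<in> {1..<m}" "c = e i k" using c unfolding C_def by blast
        then have "b c = 6 * \<alpha> k * v i" by (simp add: b_def e_def)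
        then have "\<bar>b c\<bar> = (3 / 2) * \<bar>v i\<bar>" using ak by (simp add: abs_mult)
        then show ?thesis using v[OF i(1)] by linarith
      qed
      have Bsum: "3 * B s = K + (\<Sum>c\<in>C. b c * s c)"
        if s: "\<forall>a\<in>C. s a = 1 \<or> s a = -1" "\<forall>a. a \<notin> C \<longrightarrow> s a = t a" for s
      proof -
        have "3 * (r i s)\<^sup>2 = 3 * ((\<alpha> k)\<^sup>2 + (v i)\<^sup>2) + b (e i k) * s (e i k)" if i: "i \<in> {1..<m}" for i
        proof -
          have "(\<Sum>l<k. \<alpha> l * s (e i l)) = (\<Sum>l<k. \<alpha> l * t (e i l))"
            using notC[OF i] s(2) by (intro sum.cong) auto
          moreover have "s (e i q) = t (e i q)" using notC[OF i, of q] s(2) by (auto simp: q_def)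
          ultimately have ri: "r i s = v i + \<alpha> k * s (e i k)"
            by (simp add: r_def v_def q_def flip: lessThan_Suc_atMost)
          have "e i k \<in> C" using i by (auto simp: C_def)
          then have "s (e i k) = 1 \<or> s (e i k) = -1" using s(1) by blast
          then have "(s (e i k))\<^sup>2 = 1" by auto
          moreover have "b (e i k) = 6 * \<alpha> k * v i" by (simp add: b_def e_def)
          ultimately show ?thesis
            unfolding ri by (simp add: power2_sum power_mult_distrib algebra_simps)
        qed
        then have "3 * B s = K + (\<Sum>i\<in>{1..<m}. b (e i k) * s (e i k))"
          by (simp add: B_def K_def sum_distrib_left flip: sum.distrib)
        also have "(\<Sum>i\<in>{1..<m}. b (e i k) * s (e i k)) = (\<Sum>c\<in>C. b c * s c)"
          unfolding C_def by (subst sum.reindex) (auto simp: inj_on_def dest: e_inj)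
        finally show ?thesis .
      qed
      \<comment> \<open>Multiplied by 3, the interval has length 51/4, which 7 cells of length 2
        cover.\<close>
      define p where "p = 3 * real m - 39 / 4 - K"
      have "signs_exp C (\<lambda>s. of_bool (-1 \<le> real m - B s \<and> real m - B s < 13 / 4)) t \<le>
        signs_exp C (\<lambda>s. of_bool (p \<le> (\<Sum>c\<in>C. b c * s c) \<and> (\<Sum>c\<in>C. b c * s c) < p + 2 * real 7)) t"
      proof (rule signs_exp_mono[OF fin(2)])
        fix s assume s: "\<forall>a\<in>C. s a = 1 \<or> s a = -1" "\<forall>a. a \<notin> C \<longrightarrow> s a = t a"
        show "of_bool (-1 \<le> real m - B s \<and> real m - B s < 13 / 4) \<le>
            (of_bool (p \<le> (\<Sum>c\<in>C. b c * s c) \<and> (\<Sum>c\<in>C. b c * s c) < p + 2 * real 7) :: real)"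
          using Bsum[OF s] by (auto simp: of_bool_def p_def)
      qed
      also have "\<dots> \<le> real 7 / sqrt (real (card C + 1))"
        using fin(2) b by (rule Littlewood_Offord)
      also have "card C = m - 1"
        unfolding C_def by (subst card_image) (auto simp: inj_on_def dest: e_inj)
      finally show ?thesis using m by simp
    qed
    \<comment> \<open>Averaging row 0 first makes the two bounds multiply: 42 = 6 * 7.\<close>
    have "signs_exp (C \<union> R0) ?F t \<le> 42 * u / sqrt (real m)"
      if t: "\<forall>a\<in>I - (C \<union> R0). t a = 1 \<or> t a = -1" for t
    proof -
      have "signs_exp (C \<union> R0) ?F t = signs_exp C (signs_exp R0 ?F) t"
        by (rule signs_exp_Un[OF fin(2,1) disj])
      also have "\<dots> \<le> signs_exp C (\<lambda>s. 6 * u * of_bool (-1 \<le> real m - B s \<and> real m - B s < 13 / 4)) t"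
        by (intro signs_exp_mono row0 fin)
      also have "\<dots> = 6 * u * signs_exp C (\<lambda>s. of_bool (-1 \<le> real m - B s \<and> real m - B s < 13 / 4)) t"
        by (rule signs_exp_cmult[OF fin(2)])
      also have "\<dots> \<le> 6 * u * (7 / sqrt (real m))"
        using order_trans[OF zero_le_power u(1)] by (intro mult_left_mono rows t) auto
      finally show ?thesis by simp
    qed
    then show "signs_exp {- (int m - 1)..int n - 1} ?F (\<lambda>_. 0) \<le> 42 * (real m * \<epsilon>) / sqrt (real m)"
      using sub unfolding I_def u_def by (intro signs_exp_superset_le[OF finite_atLeastAtMost_int, of "C \<union> R0"])
  qed
qed

section \<open>The lower bound\<close>

text \<open>The largest \<open>h\<close> with \<open>3204 * h\<close> at most lg(1/\<delta>) makes
  the failure probability in \<open>large_deviation\<close> at least \<open>\<delta>\<close>.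
  Rounding loses a factor of at most 2, and \<open>10 ^ 12\<close> exceeds
  \<open>3200 * 6408\<^sup>2\<close>.\<close>

lemma small_failure_prob_lower_bound:
  fixes m n :: nat and \<epsilon> \<delta> :: real
  assumes \<delta>: "0 < \<delta>" "3204 \<le> log 2 (1 / \<delta>)" and n: "log 2 (1 / \<delta>) \<le> real n" and m: "1 \<le> m"
    and \<epsilon>: "0 < \<epsilon>" "\<epsilon> < 1 / 5000"
    and good: "\<And>x. x \<in> carrier_vec n \<Longrightarrow> euclidean_norm x = 1 \<Longrightarrow>
      1 - \<delta> < measure_pmf.prob (signs_pmf m n)
        {s. \<bar>(euclidean_norm (hv_embedding m n s x))\<^sup>2 - 1\<bar> < \<epsilon>}"
  shows "(log 2 (1 / \<delta>))\<^sup>2 \<le> 10 ^ 12 * (real m * \<epsilon>\<^sup>2)"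
proof (rule ccontr)
  assume "\<not> ?thesis"
  then have small: "10 ^ 12 * (real m * \<epsilon>\<^sup>2) < (log 2 (1 / \<delta>))\<^sup>2" by simp
  define L where "L = log 2 (1 / \<delta>)"
  define h where "h = nat \<lfloor>L / 3204\<rfloor>"
  have L: "3204 \<le> L" using \<delta>(2) by (simp add: L_def)
  then have L': "1 \<le> L / 3204" by simp
  then have "1 \<le> \<lfloor>L / 3204\<rfloor>" by (simp only: one_le_floor)
  then have "1 \<le> real h" "real h \<le> L / 3204" "L / 3204 < real h + 1"
    unfolding h_def by linarith+
  then have h: "1 \<le> h" "3204 * real h \<le> L" "L \<le> 6408 * real h" by simp_all
  have hn: "2 * h \<le> n" using h(2) n by (simp add: L_def[symmetric])
  have "10 ^ 12 * (real m * \<epsilon>\<^sup>2) < L\<^sup>2" using small by (simp add: L_def)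
  also have "\<dots> \<le> (6408 * real h)\<^sup>2" using h L by (intro power_mono) auto
  also have "\<dots> = 41062464 * (real h)\<^sup>2" by (simp add: power_mult_distrib)
  finally have "15625000000 * (real m * \<epsilon>\<^sup>2) < 641601 * (real h)\<^sup>2" by simp
  then have "3200 * (real m * \<epsilon>\<^sup>2) \<le> (real h)\<^sup>2"
    using zero_le_power2[of "real h"] by linarith
  then obtain x where x: "x \<in> carrier_vec n" "euclidean_norm x = 1"
    "measure_pmf.prob (signs_pmf m n)
       {s. \<bar>(euclidean_norm (hv_embedding m n s x))\<^sup>2 - 1\<bar> < \<epsilon>} \<le> 1 - (1 / 2) ^ (3204 * h)"
    by (rule large_deviation[OF h(1) hn m \<epsilon>])
  have "\<delta> = 1 / 2 powr L" using \<delta>(1) by (simp add: L_def)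
  also have "\<dots> \<le> 1 / 2 powr real (3204 * h)" using h by (intro divide_left_mono powr_mono) auto
  also have "\<dots> = (1 / 2) ^ (3204 * h)" by (simp only: powr_realpow zero_less_numeral power_one_over)
  finally show False using x(3) good[OF x(1,2)] by linarith
qed

text \<open>For \<open>y = ln (1 / \<delta>)\<close> the inequality \<open>1 + y \<le> exp y\<close>
  gives \<open>y \<le> (1 - \<delta>) * (1 + y)\<close>, and \<open>y\<close> is bounded.\<close>

lemma log2_le_failure_complement:
  assumes "0 < \<delta>" "\<delta> < 1" "log 2 (1 / \<delta>) < 3204"
  shows "log 2 (1 / \<delta>) \<le> 7000 * (1 - \<delta>)" "0 < log 2 (1 / \<delta>)"
proof -
  define y where "y = ln (1 / \<delta>)"
  have y: "0 < y" using assms by (simp add: y_def)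
  have ln2: "1 / 2 \<le> ln (2::real)" "ln (2::real) \<le> 1"
    using ln2_ge_two_thirds ln_2_less_1 by auto
  have L: "log 2 (1 / \<delta>) = y / ln 2" by (simp add: log_def y_def)
  then show "0 < log 2 (1 / \<delta>)" using y by simp
  have "y / ln 2 < 3204" using assms(3) L by simp
  then have "y < 3204 * ln 2" by (simp add: pos_divide_less_eq)
  then have y2: "y \<le> 3204" using ln2 by linarith
  have "exp y = 1 / \<delta>" using assms by (simp add: y_def)
  then have "1 + y \<le> 1 / \<delta>" using exp_ge_add_one_self[of y] by simp
  then have "\<delta> * (1 + y) \<le> 1" using assms by (simp add: field_simps)
  then have "y \<le> (1 - \<delta>) * (1 + y)" by (simp add: algebra_simps)
  also have "\<dots> \<le> (1 - \<delta>) * 3205" using y2 assms by (intro mult_left_mono) auto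
  finally have "y \<le> (1 - \<delta>) * 3205" .
  moreover have "y / ln 2 \<le> y / (1 / 2)" using y ln2 by (intro divide_left_mono) auto
  ultimately show "log 2 (1 / \<delta>) \<le> 7000 * (1 - \<delta>)" unfolding L using assms by simp
qed

text \<open>If the bound fails, \<open>sqrt m * \<epsilon>\<close> is small compared with
  \<open>1 - \<delta>\<close>, and a small-ball lemma provides a unit vector with success
  probability at most \<open>1 - \<delta>\<close>.\<close>

lemma moderate_failure_prob_lower_bound:
  fixes \<delta> :: real
  assumes \<delta>: "0 < \<delta>" "\<delta> < 1" "log 2 (1 / \<delta>) < 3204"
  shows "\<exists>N. \<forall>m n \<epsilon>. 1 \<le> m \<longrightarrow> N \<le> n \<longrightarrow> 0 < \<epsilon> \<longrightarrow>
    (\<forall>x\<in>carrier_vec n. euclidean_norm x = 1 \<longrightarrow>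
      1 - \<delta> < measure_pmf.prob (signs_pmf m n)
        {s. \<bar>(euclidean_norm (hv_embedding m n s x))\<^sup>2 - 1\<bar> < \<epsilon>}) \<longrightarrow>
    (log 2 (1 / \<delta>))\<^sup>2 \<le> 10 ^ 12 * (real m * \<epsilon>\<^sup>2)"
proof -
  define \<eta> where "\<eta> = 1 - \<delta>"
  \<comment> \<open>This is 7000 / 10^6, from the negated bound. It satisfies
    \<open>42 * \<kappa> \<le> 1\<close> and \<open>\<kappa> + 1 / 2 \<le> 1\<close>, as the two
    cases need.\<close>
  define \<kappa> where "\<kappa> = (7 / 1000 :: real)"
  have \<eta>: "0 < \<eta>" "\<eta> < 1" using \<delta> by (auto simp: \<eta>_def)
  obtain k where k: "(1 / 2 :: real) ^ Suc k \<le> \<kappa> * \<eta>"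
  proof -
    obtain k where "(1 / 2 :: real) ^ k < \<kappa> * \<eta>"
      using real_arch_pow_inv[of "\<kappa> * \<eta>" "1 / 2"] \<eta> by (auto simp: \<kappa>_def)
    moreover have "(1 / 2 :: real) ^ Suc k \<le> (1 / 2) ^ k" by (intro power_decreasing) auto
    ultimately have "(1 / 2 :: real) ^ Suc k \<le> \<kappa> * \<eta>" by (meson le_less_trans less_imp_le)
    then show thesis by (rule that)
  qed
  define M where "M = nat \<lceil>4 / \<eta>\<^sup>2\<rceil>"
  define N where "N = Suc k * M + 2"
  have "(log 2 (1 / \<delta>))\<^sup>2 \<le> 10 ^ 12 * (real m * \<epsilon>\<^sup>2)"
    if m: "1 \<le> m" and n: "N \<le> n" and \<epsilon>: "0 < \<epsilon>"
      and good: "\<forall>x\<in>carrier_vec n. euclidean_norm x = 1 \<longrightarrow>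
        1 - \<delta> < measure_pmf.prob (signs_pmf m n)
          {s. \<bar>(euclidean_norm (hv_embedding m n s x))\<^sup>2 - 1\<bar> < \<epsilon>}" for m n \<epsilon>
  proof (rule ccontr)
    assume "\<not> ?thesis"
    then have "10 ^ 12 * (real m * \<epsilon>\<^sup>2) < (log 2 (1 / \<delta>))\<^sup>2" by simp
    also have "\<dots> \<le> (7000 * \<eta>)\<^sup>2"
      using log2_le_failure_complement[OF \<delta>] unfolding \<eta>_def by (intro power_mono) auto
    finally have "real m * \<epsilon>\<^sup>2 \<le> (\<kappa> * \<eta>)\<^sup>2" by (simp add: \<kappa>_def power_mult_distrib power2_eq_square mult_ac)
    then have "(sqrt (real m) * \<epsilon>)\<^sup>2 \<le> (\<kappa> * \<eta>)\<^sup>2" by (simp add: power_mult_distrib)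
    then have "sqrt (real m) * \<epsilon> \<le> \<kappa> * \<eta>"
      by (rule power2_le_imp_le) (use \<eta> in \<open>simp add: \<kappa>_def\<close>)
    \<comment> \<open>\<open>\<epsilon>\<close> may be arbitrarily small, but
      \<open>separated_small_ball\<close> needs \<open>m * \<epsilon>\<close> bounded below.
      Enlarging it to \<open>\<epsilon>'\<close> only increases the success probability.\<close>
    define \<epsilon>' where "\<epsilon>' = \<kappa> * \<eta> / sqrt (real m)"
    have sm: "0 < sqrt (real m)" "1 \<le> sqrt (real m)" using m by auto
    have e': "\<epsilon> \<le> \<epsilon>'" using \<open>sqrt (real m) * \<epsilon> \<le> _\<close> sm by (simp add: \<epsilon>'_def field_simps)
    have me': "real m * \<epsilon>' = \<kappa> * \<eta> * sqrt (real m)"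
    proof -
      have "real m = sqrt (real m) * sqrt (real m)" by simp
      then show ?thesis using sm unfolding \<epsilon>'_def by (metis (no_types, opaque_lifting) nonzero_mult_div_cancel_left less_irrefl mult.assoc mult.commute times_divide_eq_right)
    qed
    have bad: False if x: "x \<in> carrier_vec n" "euclidean_norm x = 1"
      and p: "measure_pmf.prob (signs_pmf m n)
          {s. \<bar>(euclidean_norm (hv_embedding m n s x))\<^sup>2 - 1\<bar> < \<epsilon>'} \<le> p" "p \<le> \<eta>" for x p
    proof -
      have "measure_pmf.prob (signs_pmf m n) {s. \<bar>(euclidean_norm (hv_embedding m n s x))\<^sup>2 - 1\<bar> < \<epsilon>}
        \<le> measure_pmf.prob (signs_pmf m n) {s. \<bar>(euclidean_norm (hv_embedding m n s x))\<^sup>2 - 1\<bar> < \<epsilon>'}"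
        using e' by (intro measure_pmf.finite_measure_mono) auto
      then show False using good x p by (fastforce simp: \<eta>_def)
    qed
    show False
    \<comment> \<open>For large \<open>m\<close> the rounding term \<open>1 / sqrt m\<close> is at
      most \<open>\<eta> / 2\<close>. Otherwise \<open>m < M\<close>, so \<open>N\<close> provides
      enough columns for the separated support.\<close>
    proof (cases "4 / \<eta>\<^sup>2 \<le> real m")
      case True
      have "(2 / \<eta>)\<^sup>2 \<le> real m" using True by (simp add: power_divide)
      then have "2 / \<eta> \<le> sqrt (real m)" by (rule real_le_rsqrt)
      then have "1 / sqrt (real m) \<le> \<eta> / 2" using \<eta> sm by (simp add: field_simps)
      moreover have "(real m * \<epsilon>' + 1) / sqrt (real m) = \<kappa> * \<eta> + 1 / sqrt (real m)"
        using sm by (simp add: me' add_divide_distrib)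
      ultimately have le: "(real m * \<epsilon>' + 1) / sqrt (real m) \<le> \<eta>" using \<eta> by (simp add: \<kappa>_def)
      have n2: "2 \<le> n" and e0: "0 < \<epsilon>'" using n e' \<epsilon> by (auto simp: N_def)
      obtain x where x: "x \<in> carrier_vec n" "euclidean_norm x = 1"
        "measure_pmf.prob (signs_pmf m n)
          {s. \<bar>(euclidean_norm (hv_embedding m n s x))\<^sup>2 - 1\<bar> < \<epsilon>'} \<le> (real m * \<epsilon>' + 1) / sqrt (real m)"
        by (rule two_point_small_ball[OF n2 m e0])
      show False by (rule bad[OF x le])
    next
      case False
      then have "real m < real M" unfolding M_def by linarith
      then have "Suc k * m \<le> Suc k * M" by (intro mult_left_mono) auto
      then have n': "Suc k * m + 1 \<le> n" using n by (simp add: N_def)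
      have "real m \<le> (2 / \<eta>)\<^sup>2" using False by (simp add: power_divide)
      then have "sqrt (real m) \<le> 2 / \<eta>" using \<eta> by (intro real_le_lsqrt) auto
      then have "\<eta> * sqrt (real m) \<le> 2" using \<eta> by (simp add: field_simps)
      then have u1: "real m * \<epsilon>' \<le> 1" by (simp add: me' \<kappa>_def)
      have "\<kappa> * \<eta> * 1 \<le> \<kappa> * \<eta> * sqrt (real m)" using \<eta> sm by (intro mult_left_mono) (auto simp: \<kappa>_def)
      then have u2: "(1 / 2) ^ Suc k \<le> real m * \<epsilon>'" using k by (simp add: me')
      have le: "42 * (real m * \<epsilon>') / sqrt (real m) \<le> \<eta>" using \<eta> sm by (simp add: me' \<kappa>_def)
      obtain x where x: "x \<in> carrier_vec n" "euclidean_norm x = 1"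
        "measure_pmf.prob (signs_pmf m n)
          {s. \<bar>(euclidean_norm (hv_embedding m n s x))\<^sup>2 - 1\<bar> < \<epsilon>'} \<le> 42 * (real m * \<epsilon>') / sqrt (real m)"
        by (rule separated_small_ball[OF m n' u2 u1])
      show False by (rule bad[OF x le])
    qed
  qed
  then show ?thesis by blast
qed

text \<open>Some lower bound on \<open>n\<close> is unavoidable: for \<open>n = 1\<close> the
  embedding is an isometry. For \<delta> > 1 the probability condition would be vacuous, whence
  \<open>\<delta> \<le> 1\<close>.\<close>

theorem theorem2:
  shows "\<exists>C>0. \<exists>c>0. \<exists>N :: real \<Rightarrow> nat.
    (\<lambda>\<delta>. real (N \<delta>)) \<in> O[at_right 0](\<lambda>\<delta>. log 2 (1 / \<delta>)) \<and>
    (\<forall>(\<epsilon>::real) (\<delta>::real) (m::nat) (n::nat).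
       0 < \<epsilon> \<longrightarrow> \<epsilon> < C \<longrightarrow> 0 < \<delta> \<longrightarrow> \<delta> \<le> 1 \<longrightarrow> 1 \<le> m \<longrightarrow> 1 \<le> n \<longrightarrow> N \<delta> \<le> n \<longrightarrow>
       (\<forall>x \<in> carrier_vec n. euclidean_norm x = 1 \<longrightarrow>
          measure_pmf.prob (signs_pmf m n)
            {s. \<bar>(euclidean_norm (hv_embedding m n s x))\<^sup>2 - 1\<bar> < \<epsilon>} > 1 - \<delta>) \<longrightarrow>
       real m \<ge> c * (1 / \<epsilon>\<^sup>2) * (log 2 (1 / \<delta>))\<^sup>2)"
proof -
  define good where "good = (\<lambda>m n \<epsilon> \<delta>. \<forall>x\<in>carrier_vec n. euclidean_norm x = 1 \<longrightarrow>
      1 - \<delta> < measure_pmf.prob (signs_pmf m n)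
        {s. \<bar>(euclidean_norm (hv_embedding m n s x))\<^sup>2 - 1\<bar> < (\<epsilon>::real)})"
  have "\<exists>N. \<forall>\<delta>. 0 < \<delta> \<and> \<delta> < 1 \<and> log 2 (1 / \<delta>) < 3204 \<longrightarrow>
      (\<forall>m n \<epsilon>. 1 \<le> m \<longrightarrow> N \<delta> \<le> n \<longrightarrow> 0 < \<epsilon> \<longrightarrow> good m n \<epsilon> \<delta> \<longrightarrow>
        (log 2 (1 / \<delta>))\<^sup>2 \<le> 10 ^ 12 * (real m * \<epsilon>\<^sup>2))"
    unfolding good_def by (rule choice) (use moderate_failure_prob_lower_bound in blast)
  then obtain N0 where N0: "\<And>\<delta> m n \<epsilon>. 0 < \<delta> \<Longrightarrow> \<delta> < 1 \<Longrightarrow> log 2 (1 / \<delta>) < 3204 \<Longrightarrow>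
      1 \<le> m \<Longrightarrow> N0 \<delta> \<le> n \<Longrightarrow> 0 < \<epsilon> \<Longrightarrow> good m n \<epsilon> \<delta> \<Longrightarrow>
        (log 2 (1 / \<delta>))\<^sup>2 \<le> 10 ^ 12 * (real m * \<epsilon>\<^sup>2)"
    by blast
  \<comment> \<open>Near 0 the threshold is lg(1/\<delta>), rounded up. The values
    \<open>N0 \<delta>\<close> come without a bound, but the growth condition concerns only \<delta>
    tending to 0.\<close>
  define N where "N = (\<lambda>\<delta>. if 3204 \<le> log 2 (1 / \<delta>) then nat \<lceil>log 2 (1 / \<delta>)\<rceil> else N0 \<delta>)"
  have bigo: "(\<lambda>\<delta>. real (N \<delta>)) \<in> O[at_right 0](\<lambda>\<delta>. log 2 (1 / \<delta>))"
  proof (rule bigoI[where c = 2], rule eventually_at_rightI[where b = "2 powr (-3204)"])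
    fix \<delta> :: real assume d: "\<delta> \<in> {0<..<2 powr (-3204)}"
    then have "log 2 \<delta> < log 2 (2 powr (-3204))" by (subst log_less_cancel_iff) auto
    then have L: "3204 \<le> log 2 (1 / \<delta>)" using d by (simp add: log_divide)
    then have "real (N \<delta>) \<le> log 2 (1 / \<delta>) + 1" unfolding N_def by simp
    then show "norm (real (N \<delta>)) \<le> 2 * norm (log 2 (1 / \<delta>))" using L by simp
  qed simp
  have main: "real m \<ge> (1 / 10 ^ 12) * (1 / \<epsilon>\<^sup>2) * (log 2 (1 / \<delta>))\<^sup>2"
    if \<epsilon>: "0 < \<epsilon>" "\<epsilon> < 1 / 5000" and \<delta>: "0 < \<delta>" "\<delta> \<le> 1" and mn: "1 \<le> m" "N \<delta> \<le> n" and g: "good m n \<epsilon> \<delta>"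
    for \<epsilon> \<delta> m n
  proof -
    have "(log 2 (1 / \<delta>))\<^sup>2 \<le> 10 ^ 12 * (real m * \<epsilon>\<^sup>2)"
    proof (cases "3204 \<le> log 2 (1 / \<delta>)")
      case True
      then have "log 2 (1 / \<delta>) \<le> real n" using mn(2) unfolding N_def by simp
      then show ?thesis
        using g unfolding good_def by (intro small_failure_prob_lower_bound[OF \<delta>(1) True _ mn(1) \<epsilon>]) auto
    next
      case False
      show ?thesis
      proof (cases "\<delta> = 1")
        case True
        then show ?thesis by simp
      next
        case False
        with \<delta> \<open>\<not> 3204 \<le> _\<close> mn \<epsilon> g show ?thesis by (intro N0[of \<delta> m n \<epsilon>]) (auto simp: N_def)
      qed
    qed
    then show ?thesis using \<epsilon> by (simp add: field_simps)
  qed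
  show ?thesis
    using bigo main unfolding good_def
    by (intro exI[of _ "1 / 5000 :: real"] exI[of _ "1 / 10 ^ 12 :: real"] exI[of _ N] conjI) auto
qed

end
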